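(* For every positive integer $n$, the state complex $\mathcal{S}(SR_n)$ of the robotic arm $SR_n$ of length $n$ in a strip of width $1$ is a CAT(0) cubical complex.
   Context: The robotic arm $SR_n$ consists of $n$ unit links attached sequentially, living in the $1\times n$ grid $[0,n]\times[0,1]$ with base fixed at $(0,0)$; each link faces north, south or east, and the arm (a lattice path) never visits a point twice. A position is determined by the set $A\subseteq[n]$ of indices of its vertical links, and the positions correspond exactly to the spread-out subsets of $[n]$ (subsets containing no two consecutive integers). Moves: (corner switch) for $1\le i\le n-1$, two consecutive links $i,i+1$ facing different directions interchange their directions, provided the result is a valid position (in terms of $A$: replace $i$ by $i+1$ or $i+1$ by $i$ when the result is spread out); this move changes links $\{i,i+1\}$ and involves links $\{i-1,i,i+1,i+2\}\cap[n]$. (End flip) the last link rotates $90^\circ$ between horizontal and vertical, provided the result is a valid position (in terms of $A$: add or remove $n$ keeping $A$ spread out); it changes link $\{n\}$ and involves links $\{n-1,n\}\cap[n]$. Two moves commute if the links changed by each are disjoint from the links involved in the other. The state complex $\mathcal{S}(SR_n)$ is the cubical complex whose vertices are the states, and where for each state $u$ and each set of $k$ pairwise commuting moves all applicable at $u$, the $2^k$ states obtained by applying subsets of these moves to $u$ are the vertices of a $k$-cube; cubes are glued along common faces. Each cube carries the Euclidean metric of a unit cube, and distance is the infimum of lengths of piecewise linear paths. A metric space is CAT(0) if any two points are joined by a unique geodesic and every geodesic triangle is thin (every chord is no longer than the corresponding chord of a Euclidean comparison triangle with the same side lengths). *)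

theory Defs
  imports "HOL-Analysis.Analysis"
begin

section \<open>CAT(0) metric spaces\<close>

definition (in Metric_space) geodesic :: "'a \<Rightarrow> 'a \<Rightarrow> (real \<Rightarrow> 'a) \<Rightarrow> bool" where
  "geodesic x y \<gamma> \<longleftrightarrow>
     \<gamma> ` {0..d x y} \<subseteq> M \<and> \<gamma> 0 = x \<and> \<gamma> (d x y) = y \<and>
     (\<forall>s\<in>{0..d x y}. \<forall>t\<in>{0..d x y}. d (\<gamma> s) (\<gamma> t) = \<bar>s - t\<bar>)"

text \<open>
  In \<open>thin\<close>, the points \<open>a\<close>, \<open>b\<close>, \<open>c\<close> form a comparison triangle for \<open>x\<close>, \<open>y\<close>, \<open>z\<close> (one always
  exists, by the triangle inequality), and \<open>p\<close>, \<open>q\<close> are the comparison points of \<open>\<alpha> s\<close>, \<open>\<beta> t\<close>.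
  Any two sides of a triangle share a vertex, and \<open>x\<close> ranges over all three vertices, so all
  chords are covered.
\<close>

locale CAT0_space = Metric_space M d for M :: "'a set" and d :: "'a \<Rightarrow> 'a \<Rightarrow> real" +
  assumes geodesic_exists:
      "\<lbrakk>x \<in> M; y \<in> M\<rbrakk> \<Longrightarrow> \<exists>\<gamma>. geodesic x y \<gamma>"
    and geodesic_unique:
      "\<lbrakk>x \<in> M; y \<in> M; geodesic x y \<gamma>; geodesic x y \<gamma>'; s \<in> {0..d x y}\<rbrakk> \<Longrightarrow> \<gamma> s = \<gamma>' s"
    and thin:
      "\<And>x y z \<alpha> \<beta> s t (a :: real^2) b c p q.
        \<lbrakk>x \<in> M; y \<in> M; z \<in> M; geodesic x y \<alpha>; geodesic x z \<beta>;
         s \<in> {0..d x y}; t \<in> {0..d x z};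
         dist a b = d x y; dist a c = d x z; dist b c = d y z;
         p \<in> closed_segment a b; dist a p = s;
         q \<in> closed_segment a c; dist a q = t\<rbrakk>
        \<Longrightarrow> d (\<alpha> s) (\<beta> t) \<le> dist p q"


section \<open>Cubical complexes\<close>

text \<open>
  A cube is given by its set of directions and its corners: \<open>corner c T\<close> is the vertex reached
  from the base vertex \<open>corner c {}\<close> by traversing the directions in \<open>T\<close>. Only the values of
  \<open>corner c\<close> on subsets of \<open>dirs c\<close> matter.
\<close>

datatype ('i, 'v) cube = Cube (dirs: "'i set") (corner: "'i set \<Rightarrow> 'v")

text \<open>
  The point with coordinates \<open>t\<close> in the unit cube is represented by its multilinear weights on
  the vertices. Weights vanish outside the smallest face containing the point, so this glues cubes
  along common faces: a point of a common face has the same weights in each of the cubes.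
\<close>

definition cube_point :: "('i, 'v) cube \<Rightarrow> ('i \<Rightarrow> real) \<Rightarrow> 'v \<Rightarrow> real" where
  "cube_point c t v =
     (\<Sum>T | T \<subseteq> dirs c \<and> corner c T = v. (\<Prod>i\<in>T. t i) * (\<Prod>i\<in>dirs c - T. 1 - t i))"

definition cell :: "('i, 'v) cube \<Rightarrow> ('v \<Rightarrow> real) set" where
  "cell c = cube_point c ` (dirs c \<rightarrow> {0..1})"

text \<open>
  The inverse of \<^const>\<open>cube_point\<close>; see \<open>coord_cube_point\<close> below.
\<close>

definition coord :: "('i, 'v) cube \<Rightarrow> ('v \<Rightarrow> real) \<Rightarrow> 'i \<Rightarrow> real" where
  "coord c p i = (\<Sum>T | T \<subseteq> dirs c \<and> i \<in> T. p (corner c T))"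

definition cube_dist :: "('i, 'v) cube \<Rightarrow> ('v \<Rightarrow> real) \<Rightarrow> ('v \<Rightarrow> real) \<Rightarrow> real" where
  "cube_dist c p q = L2_set (\<lambda>i. coord c p i - coord c q i) (dirs c)"

text \<open>
  The faces of a cube: directions in \<open>J\<close> vary, those in \<open>K\<close> are fixed at 1, all others at 0.
\<close>

definition faces :: "('i, 'v) cube \<Rightarrow> ('v \<Rightarrow> real) set set" where
  "faces c = {cell (Cube J (\<lambda>T. corner c (T \<union> K))) | J K. J \<subseteq> dirs c \<and> K \<subseteq> dirs c - J}"

definition cubical_complex :: "('i, 'v) cube set \<Rightarrow> bool" where
  "cubical_complex X \<longleftrightarrow>
     (\<forall>c\<in>X. finite (dirs c) \<and> inj_on (corner c) (Pow (dirs c))) \<and>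
     (\<forall>c\<in>X. faces c \<subseteq> cell ` X) \<and>
     (\<forall>c\<in>X. \<forall>c'\<in>X. cell c \<inter> cell c' \<noteq> {} \<longrightarrow> cell c \<inter> cell c' \<in> faces c \<inter> faces c') \<and>
     (\<forall>c\<in>X. \<forall>c'\<in>X. \<forall>p\<in>cell c \<inter> cell c'. \<forall>q\<in>cell c \<inter> cell c'.
        cube_dist c p q = cube_dist c' p q)"

definition realization :: "('i, 'v) cube set \<Rightarrow> ('v \<Rightarrow> real) set" where
  "realization X = (\<Union>c\<in>X. cell c)"

text \<open>
  \<open>pl_path X p q l\<close>: some piecewise linear path, that is, a finite concatenation of straight
  segments each lying in a single cube, joins \<open>p\<close> to \<open>q\<close> and has length \<open>l\<close>.
\<close>

inductive pl_path ::
    "('i, 'v) cube set \<Rightarrow> ('v \<Rightarrow> real) \<Rightarrow> ('v \<Rightarrow> real) \<Rightarrow> real \<Rightarrow> bool"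
  for X where
    pl_path_refl: "p \<in> realization X \<Longrightarrow> pl_path X p p 0"
  | pl_path_step: "\<lbrakk>c \<in> X; p \<in> cell c; q \<in> cell c; pl_path X q r l\<rbrakk>
      \<Longrightarrow> pl_path X p r (cube_dist c p q + l)"

text \<open>
  The value 0 for points that no path joins is a dummy. If such points exist in the realization,
  they violate the metric axioms, so that a complex that is not connected is never CAT(0) below.
\<close>

definition pl_dist :: "('i, 'v) cube set \<Rightarrow> ('v \<Rightarrow> real) \<Rightarrow> ('v \<Rightarrow> real) \<Rightarrow> real" where
  "pl_dist X p q = (if \<exists>l. pl_path X p q l then Inf {l. pl_path X p q l} else 0)"

definition CAT0_cubical_complex :: "('i, 'v) cube set \<Rightarrow> bool" where
  "CAT0_cubical_complex X \<longleftrightarrow> cubical_complex X \<and> CAT0_space (realization X) (pl_dist X)"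

lemma coord_cube_point:
  assumes fin: "finite (dirs c)" and inj: "inj_on (corner c) (Pow (dirs c))" and i: "i \<in> dirs c"
  shows "coord c (cube_point c t) i = t i"
proof -
  let ?w = "\<lambda>T. (\<Prod>j\<in>T. t j) * (\<Prod>j\<in>dirs c - T. 1 - t j)"
  let ?b = "\<lambda>j. if j = i then 0 else 1 - t j"
  have w: "cube_point c t (corner c T) = ?w T" if "T \<subseteq> dirs c" for T
  proof -
    have "{S. S \<subseteq> dirs c \<and> corner c S = corner c T} = {T}"
      using inj that by (auto simp: inj_on_def)
    then show ?thesis by (simp add: cube_point_def)
  qed
  have b: "(\<Prod>j\<in>T. t j) * (\<Prod>j\<in>dirs c - T. ?b j) = (if i \<in> T then ?w T else 0)"
    if "T \<subseteq> dirs c" for T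
  proof (cases "i \<in> T")
    case True
    then have "(\<Prod>j\<in>dirs c - T. ?b j) = (\<Prod>j\<in>dirs c - T. 1 - t j)"
      by (intro prod.cong) auto
    with True show ?thesis by simp
  next
    case False
    then have "(\<Prod>j\<in>dirs c - T. ?b j) = 0"
      using fin i by (intro prod_zero) auto
    with False show ?thesis by simp
  qed
  have "coord c (cube_point c t) i = (\<Sum>T | T \<subseteq> dirs c \<and> i \<in> T. ?w T)"
    unfolding coord_def by (intro sum.cong) (auto simp: w)
  also have "\<dots> = (\<Sum>T\<in>Pow (dirs c). if i \<in> T then ?w T else 0)"
    using fin by (subst sum.inter_filter[symmetric]) (auto intro!: sum.cong)
  also have "\<dots> = (\<Sum>T\<in>Pow (dirs c). (\<Prod>j\<in>T. t j) * (\<Prod>j\<in>dirs c - T. ?b j))"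
    by (intro sum.cong) (auto simp: b)
  also have "\<dots> = (\<Prod>j\<in>dirs c. t j + ?b j)"
    using fin by (simp add: prod_add)
  also have "\<dots> = (\<Prod>j\<in>dirs c. if j = i then t i else 1)"
    by (intro prod.cong) auto
  also have "\<dots> = t i"
    using fin i by simp
  finally show ?thesis .
qed


section \<open>The robotic arm in a strip of width 1\<close>

datatype heading = North | South | East

fun link_vector :: "heading \<Rightarrow> int \<times> int" where
  "link_vector North = (0, 1)"
| "link_vector South = (0, -1)"
| "link_vector East = (1, 0)"

text \<open>
  A position is the list of headings of the links, starting at the base. The links are thus
  numbered from 0 to \<open>n - 1\<close>.
\<close>

definition joint :: "heading list \<Rightarrow> nat \<Rightarrow> int \<times> int" where
  "joint u k = (\<Sum>j<k. link_vector (u ! j))"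

definition positions :: "nat \<Rightarrow> heading list set" where
  "positions n =
     {u. length u = n \<and> joint u ` {..n} \<subseteq> {0..int n} \<times> {0..1} \<and> inj_on (joint u) {..n}}"

text \<open>\<open>Corner_Switch i\<close> acts on the links \<open>i\<close> and \<open>i + 1\<close>.\<close>

datatype move = Corner_Switch nat | End_Flip

text \<open>
  A horizontal last link can only rotate towards the other side of the strip, since the rotation in
  the other direction leaves the strip.
\<close>

fun perform :: "nat \<Rightarrow> move \<Rightarrow> heading list \<Rightarrow> heading list" where
  "perform n (Corner_Switch i) u = u[i := u ! Suc i, Suc i := u ! i]"
| "perform n End_Flip u =
     u[n - 1 := if u ! (n - 1) \<noteq> East then East
                else if snd (joint u (n - 1)) = 0 then North else South]"

fun applicable :: "nat \<Rightarrow> move \<Rightarrow> heading list \<Rightarrow> bool" where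
  "applicable n (Corner_Switch i) u \<longleftrightarrow>
     Suc i < n \<and> u ! i \<noteq> u ! Suc i \<and> perform n (Corner_Switch i) u \<in> positions n"
| "applicable n End_Flip u \<longleftrightarrow> 0 < n \<and> perform n End_Flip u \<in> positions n"

fun changed :: "nat \<Rightarrow> move \<Rightarrow> nat set" where
  "changed n (Corner_Switch i) = {i, i + 1}"
| "changed n End_Flip = {n - 1}"

text \<open>Subtraction on \<^typ>\<open>nat\<close> truncates at 0, which is harmless here.\<close>

fun involved :: "nat \<Rightarrow> move \<Rightarrow> nat set" where
  "involved n (Corner_Switch i) = {i - 1..i + 2} \<inter> {..<n}"
| "involved n End_Flip = {n - 2..n - 1} \<inter> {..<n}"

definition commuting :: "nat \<Rightarrow> move \<Rightarrow> move \<Rightarrow> bool" where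
  "commuting n m m' \<longleftrightarrow>
     changed n m \<inter> involved n m' = {} \<and> changed n m' \<inter> involved n m = {}"

text \<open>
  \<open>Finite_Set.fold (perform n) u T\<close> applies all moves in \<open>T\<close> to \<open>u\<close>; the order is irrelevant as
  the moves commute.
\<close>

definition state_complex :: "nat \<Rightarrow> (move, heading list) cube set" where
  "state_complex n =
     {Cube N (Finite_Set.fold (perform n) u) | u N.
        u \<in> positions n \<and> (\<forall>m\<in>N. applicable n m u) \<and> pairwise (commuting n) N}"

end

theory Submission
  imports Defs
begin

text \<open>
  Record a position by its heights, the numbers of vertical links among the first \<open>k\<close> links. Each
  move changes one height by 1, and the height vectors form a distributive lattice of integer
  vectors, so the state complex is the union of the unit cubes of \<open>\<real>\<^sup>n\<close> all of whose corners lie in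
  this lattice, with the induced path metric.

  A metric space is CAT(0) if any \<open>y\<close>, \<open>z\<close> are joined by points that satisfy the inequality of Bruhat
  and Tits, and this condition survives gluing two spaces along a common subspace that satisfies it
  as well (Reshetnyak). An interval of the lattice spans either a single cube, which is Euclidean, or
  it is the union of two smaller intervals that meet in a third one. Clamping coordinates is
  1-Lipschitz, so intervals are isometrically embedded, and induction applies.
\<close>

section \<open>The Bruhat-Tits inequality and gluing\<close>

text \<open>A corner switch alters two entries of the indicator vector of \<open>A\<close> but only
  one of its partial sums. With heights, every move is therefore a unit step along a coordinate
  axis. The conditions on heights couple only entries at distance at most 2, which matches the
  distance 3 from which on moves commute. The induction runs over all intervals and not just the
  whole complex, because gluing also consumes the inequality on the intersection, which must be of
  the same form. The obstacle is the metric: distances are infima over paths in the whole complex,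
  which may leave the interval being cut, whereas gluing asks for a crossing point at which the
  distance splits exactly. Clamping returns the path to the interval, and compactness turns nearly
  optimal crossing points into an optimal one.\<close>

context Metric_space begin

text \<open>
  Equality holds in Euclidean space for \<open>m = (1 - l) y + l z\<close> (Stewart's theorem); the case
  \<open>l = 1/2\<close> is the inequality of Bruhat and Tits. Demanding a point \<open>m\<close> for every \<open>l\<close>, and not just
  midpoints, yields geodesics without any completeness assumption.
\<close>

definition cn :: "'a \<Rightarrow> 'a \<Rightarrow> 'a \<Rightarrow> real \<Rightarrow> 'a \<Rightarrow> bool" where
  "cn x y z l m \<longleftrightarrow> (d x m)\<^sup>2 \<le> (1 - l) * (d x y)\<^sup>2 + l * (d x z)\<^sup>2 - l * (1 - l) * (d y z)\<^sup>2"

definition CN :: "'a set \<Rightarrow> bool" where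
  "CN A \<longleftrightarrow> (\<forall>y\<in>A. \<forall>z\<in>A. \<forall>l\<in>{0..1}. \<exists>m\<in>A. \<forall>x\<in>A. cn x y z l m)"

lemma CN_point:
  assumes "CN A" "y \<in> A" "z \<in> A" "l \<in> {0..1}"
  obtains m where "m \<in> A" "\<And>x. x \<in> A \<Longrightarrow> cn x y z l m"
  using assms unfolding CN_def by blast

lemma cn_swap: "cn x y z l m \<longleftrightarrow> cn x z y (1 - l) m"
  unfolding cn_def by (simp add: commute algebra_simps)

text \<open>At \<open>x = y\<close> the right-hand side collapses to
  \<open>(l * d y z)\<^sup>2\<close>.\<close>

lemma cn_left:
  assumes "y \<in> M" "cn y y z l m" "0 \<le> l"
  shows "d y m \<le> l * d y z"
proof -
  have "(d y m)\<^sup>2 \<le> (l * d y z)\<^sup>2"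
    using assms by (simp add: cn_def power2_eq_square algebra_simps)
  then show ?thesis using assms(3) by (meson mult_nonneg_nonneg nonneg power2_le_imp_le)
qed

lemma cn_right:
  assumes "z \<in> M" "cn z y z l m" "l \<le> 1"
  shows "d m z \<le> (1 - l) * d y z"
  using cn_left[of z y "1 - l" m] assms cn_swap[of z y z l m] by (simp add: commute)

lemma cn_between:
  assumes "y \<in> M" "z \<in> M" "m \<in> M" "l \<in> {0..1}" "cn y y z l m" "cn z y z l m"
  shows "d y m = l * d y z" "d m z = (1 - l) * d y z"
proof -
  have "d y m \<le> l * d y z" "d m z \<le> (1 - l) * d y z"
    using cn_left[of y z l m] cn_right[of z y l m] assms by auto
  moreover have "d y z \<le> d y m + d m z" using assms triangle by blast
  ultimately show "d y m = l * d y z" "d m z = (1 - l) * d y z"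
    by (auto simp: algebra_simps)
qed

text \<open>Tested at \<open>m'\<close>, the right-hand side is \<open>d y z\<close> squared times
  \<open>(1 - l) * l\<^sup>2 + l * (1 - l)\<^sup>2 - l * (1 - l)\<close>, which is 0.\<close>

lemma cn_unique:
  assumes "m \<in> M" "m' \<in> M" "cn m' y z l m" "d y m' = l * d y z" "d m' z = (1 - l) * d y z"
  shows "m' = m"
proof -
  have "(d m' m)\<^sup>2 \<le> (1 - l) * (l * d y z)\<^sup>2 + l * ((1 - l) * d y z)\<^sup>2 - l * (1 - l) * (d y z)\<^sup>2"
    using assms(3,4,5) by (simp add: cn_def commute[of m' y])
  also have "\<dots> = 0" by algebra
  finally show ?thesis using assms(1,2) by simp
qed

text \<open>The point of a geodesic has the distances to \<open>y\<close> and \<open>z\<close> that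
  single out the point given by \<open>CN\<close>. Both uniqueness of geodesics and thinness rest on
  this.\<close>

lemma cn_geodesic:
  assumes "CN M" "geodesic y z \<gamma>" "y \<in> M" "z \<in> M" "x \<in> M" "l \<in> {0..1}"
  shows "cn x y z l (\<gamma> (l * d y z))"
proof -
  obtain m where m: "m \<in> M" "\<And>x. x \<in> M \<Longrightarrow> cn x y z l m"
    using CN_point[OF assms(1,3,4,6)] by blast
  define s where "s = l * d y z"
  have s: "s \<in> {0..d y z}"
    using assms(6) mult_left_le_one_le[of "d y z" l] by (auto simp: s_def)
  have g: "\<gamma> s \<in> M" "\<gamma> 0 = y" "\<gamma> (d y z) = z"
    "\<And>s t. s \<in> {0..d y z} \<Longrightarrow> t \<in> {0..d y z} \<Longrightarrow> d (\<gamma> s) (\<gamma> t) = \<bar>s - t\<bar>"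
    using assms(2) s unfolding geodesic_def by blast+
  have "d y (\<gamma> s) = s" using g(2) g(4)[of 0 s] s by auto
  moreover have "d (\<gamma> s) z = d y z - s" using g(3) g(4)[of s "d y z"] s by auto
  ultimately have "\<gamma> s = m"
    using m g(1) by (intro cn_unique[where y = y and z = z and l = l])
      (auto simp: s_def algebra_simps)
  then show ?thesis using m assms(5) by (simp add: s_def)
qed

lemma CN_geodesic_exists:
  assumes "CN M" "y \<in> M" "z \<in> M"
  shows "\<exists>\<gamma>. geodesic y z \<gamma>"
proof (cases "d y z = 0")
  case True
  then have "geodesic y z (\<lambda>_. y)" using assms unfolding geodesic_def by auto
  then show ?thesis by blast
next
  case False
  define L where "L = d y z"
  have L: "L > 0" using False unfolding L_def by (simp add: order_less_le)
  obtain m where m: "\<And>l. l \<in> {0..1} \<Longrightarrow> m l \<in> M"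
      "\<And>l x. l \<in> {0..1} \<Longrightarrow> x \<in> M \<Longrightarrow> cn x y z l (m l)"
    using assms unfolding CN_def by metis
  have bt: "d y (m l) = l * L" "d (m l) z = (1 - l) * L" if "l \<in> {0..1}" for l
    using cn_between[of y z "m l" l] assms m that unfolding L_def by auto
  \<comment> \<open>The points \<open>m l\<close> are chosen independently of each other. Testing
    the inequality for \<open>m l\<close> at \<open>m k\<close> still gives exactly the distance
    required along a geodesic; the reverse bound comes from the triangle inequality at
    \<open>y\<close>.\<close>
  have le: "d (m k) (m l) \<le> \<bar>k - l\<bar> * L" if "k \<in> {0..1}" "l \<in> {0..1}" for k l
  proof -
    have "(d (m k) (m l))\<^sup>2 \<le> (1 - l) * (k * L)\<^sup>2 + l * ((1 - k) * L)\<^sup>2 - l * (1 - l) * L\<^sup>2"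
      using m(2)[OF that(2) m(1)[OF that(1)]] bt[OF that(1)]
      unfolding cn_def L_def[symmetric] by (simp add: commute[of "m k" y])
    also have "\<dots> = (\<bar>k - l\<bar> * L)\<^sup>2" by (simp add: power_mult_distrib) algebra
    finally show ?thesis using L by (meson abs_ge_zero less_imp_le mult_nonneg_nonneg power2_le_imp_le)
  qed
  have ge: "d (m k) (m l) \<ge> \<bar>k - l\<bar> * L" if "k \<in> {0..1}" "l \<in> {0..1}" for k l
  proof -
    have "d y (m l) \<le> d y (m k) + d (m k) (m l)" "d y (m k) \<le> d y (m l) + d (m l) (m k)"
      using triangle assms m(1) that by blast+
    then have "k * L - l * L \<le> d (m k) (m l)" "l * L - k * L \<le> d (m k) (m l)"
      using bt that by (auto simp: commute)
    then show ?thesis by (auto simp: abs_if algebra_simps)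
  qed
  have I: "s / L \<in> {0..1}" if "s \<in> {0..L}" for s using that L by auto
  have "geodesic y z (\<lambda>s. m (s / L))"
    unfolding geodesic_def L_def[symmetric]
  proof (intro conjI ballI)
    show "(\<lambda>s. m (s / L)) ` {0..L} \<subseteq> M" using m(1) I by blast
    show "m (0 / L) = y" using bt(1)[of 0] m(1)[of 0] assms by simp
    show "m (L / L) = z" using bt(2)[of 1] m(1)[of 1] assms L by simp
    fix s t assume "s \<in> {0..L}" "t \<in> {0..L}"
    then have "d (m (s / L)) (m (t / L)) = \<bar>s / L - t / L\<bar> * L"
      using le ge I by (meson order_antisym)
    also have "\<dots> = \<bar>s - t\<bar>"
      using L by (simp add: abs_divide flip: diff_divide_distrib)
    finally show "d (m (s / L)) (m (t / L)) = \<bar>s - t\<bar>" .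
  qed
  then show ?thesis by blast
qed

end

section \<open>From the inequality to unique geodesics and thin triangles\<close>

lemma stewart_inner:
  fixes a b w :: "'v :: real_inner"
  shows "(dist w ((1 - l) *\<^sub>R a + l *\<^sub>R b))\<^sup>2
    = (1 - l) * (dist w a)\<^sup>2 + l * (dist w b)\<^sup>2 - l * (1 - l) * (dist a b)\<^sup>2"
  by (simp add: dist_norm power2_norm_eq_inner inner_simps inner_commute algebra_simps)

theorem (in Metric_space) CN_imp_CAT0:
  assumes CN: "CN M"
  shows "CAT0_space M d"
proof unfold_locales
  fix x y assume "x \<in> M" "y \<in> M"
  then show "\<exists>\<gamma>. geodesic x y \<gamma>" using CN_geodesic_exists CN by blast
next
  fix x y \<gamma> \<gamma>' s
  assume M: "x \<in> M" "y \<in> M" and g: "geodesic x y \<gamma>" "geodesic x y \<gamma>'" and s: "s \<in> {0..d x y}"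
  \<comment> \<open>If \<open>d x y = 0\<close>, then \<open>s = 0\<close> and division by zero
    yields \<open>l = 0\<close>, so the next line holds there too.\<close>
  define l where "l = s / d x y"
  have l: "l \<in> {0..1}" "s = l * d x y" using s by (auto simp: l_def divide_simps)
  have "\<gamma>' s \<in> M" "\<gamma>' 0 = x" "\<gamma>' (d x y) = y"
    "\<And>s t. s \<in> {0..d x y} \<Longrightarrow> t \<in> {0..d x y} \<Longrightarrow> d (\<gamma>' s) (\<gamma>' t) = \<bar>s - t\<bar>"
    using g(2) s unfolding geodesic_def by blast+
  moreover from this(4)[of 0 s] this(4)[of s "d x y"] this(2,3)
  have "d x (\<gamma>' s) = l * d x y" "d (\<gamma>' s) y = (1 - l) * d x y"
    using s l(2) by (auto simp: algebra_simps)
  moreover have "\<gamma> s \<in> M" using g(1) s unfolding geodesic_def by blast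
  ultimately have "\<gamma>' s = \<gamma> s"
    using cn_geodesic[OF CN g(1) M _ l(1)] unfolding l(2)[symmetric]
    by (intro cn_unique[where y = x and z = y and l = l]) (auto simp flip: l(2))
  then show "\<gamma> s = \<gamma>' s" ..
next
  fix x y z \<alpha> \<beta> s t and a b c p q :: "real^2"
  assume M: "x \<in> M" "y \<in> M" "z \<in> M" and g: "geodesic x y \<alpha>" "geodesic x z \<beta>"
    and st: "s \<in> {0..d x y}" "t \<in> {0..d x z}"
    and abc: "dist a b = d x y" "dist a c = d x z" "dist b c = d y z"
    and pq: "p \<in> closed_segment a b" "dist a p = s" "q \<in> closed_segment a c" "dist a q = t"
  obtain k where k: "k \<in> {0..1}" "p = (1 - k) *\<^sub>R a + k *\<^sub>R b"
    using pq(1) unfolding closed_segment_def by auto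
  obtain l where l: "l \<in> {0..1}" "q = (1 - l) *\<^sub>R a + l *\<^sub>R c"
    using pq(3) unfolding closed_segment_def by auto
  have seg: "dist a ((1 - k) *\<^sub>R a + k *\<^sub>R b) = k * dist a b" if "k \<ge> 0" for k and b :: "real^2"
  proof -
    have "a - ((1 - k) *\<^sub>R a + k *\<^sub>R b) = k *\<^sub>R (a - b)" by (simp add: algebra_simps)
    then show ?thesis using that by (simp add: dist_norm)
  qed
  have s: "s = k * d x y" using seg[of k b] k pq(2) abc by auto
  have t: "t = l * d x z" using seg[of l c] l pq(4) abc by auto
  have \<alpha>: "\<alpha> s \<in> M" "\<alpha> 0 = x" "d (\<alpha> s) (\<alpha> 0) = \<bar>s - 0\<bar>"
    using g(1) st unfolding geodesic_def by auto
  \<comment> \<open>Two comparisons are chained: along \<open>\<alpha>\<close> seen from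
    \<open>z\<close>, then along \<open>\<beta>\<close> seen from \<open>\<alpha> s\<close>. By
    \<open>stewart_inner\<close> both are equalities in the plane.\<close>
  have "(d z (\<alpha> s))\<^sup>2 \<le> (dist c p)\<^sup>2"
    using cn_geodesic[OF CN g(1) M k(1)] unfolding s[symmetric] cn_def
    unfolding k(2) stewart_inner by (simp add: abc commute dist_commute)
  moreover have "d (\<alpha> s) x = dist p a"
    using \<alpha> st pq(2) by (simp add: dist_commute)
  ultimately have "(1 - l) * (d (\<alpha> s) x)\<^sup>2 + l * (d (\<alpha> s) z)\<^sup>2
      \<le> (1 - l) * (dist p a)\<^sup>2 + l * (dist p c)\<^sup>2"
    using l(1) by (intro add_mono mult_left_mono) (auto simp: commute dist_commute)
  moreover have "cn (\<alpha> s) x z l (\<beta> t)"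
    using cn_geodesic[OF CN g(2) M(1,3) \<alpha>(1) l(1)] t by simp
  ultimately have "(d (\<alpha> s) (\<beta> t))\<^sup>2 \<le> (dist p q)\<^sup>2"
    unfolding cn_def by (simp add: l(2) stewart_inner abc)
  then show "d (\<alpha> s) (\<beta> t) \<le> dist p q" using zero_le_dist by (rule power2_le_imp_le)
qed

section \<open>Reshetnyak gluing along a common subspace\<close>

context Metric_space begin

text \<open>
  In the proof, \<open>s\<close> is chosen at the parameter where the line from \<open>x\<close> to \<open>m\<close> would cross \<open>[u, v]\<close>
  in a Euclidean triangle with vertices \<open>x\<close>, \<open>w\<close>, \<open>v\<close> and with \<open>u\<close> on the side \<open>[x, w]\<close>. The bound
  on \<open>d x m\<close> comes from \<open>(f + g)\<^sup>2 \<le> f\<^sup>2 / (1 - \<sigma>) + g\<^sup>2 / \<sigma>\<close> with \<open>\<sigma> = p / S\<close>, which makes all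
  terms with \<open>d u v\<close> cancel.
\<close>

lemma cn_through_segment:
  assumes M: "x \<in> M" "u \<in> M" "v \<in> M" "w \<in> M" "m \<in> M"
    and seg: "\<And>t. t \<in> {0..1} \<Longrightarrow> \<exists>s\<in>M. cn x u v t s \<and> cn m u v t s"
    and xw: "d x w = d x u + d u w"
    and l: "l \<in> {0..1}" and m: "cn u w v l m" "d m v = (1 - l) * d w v"
  shows "cn x w v l m"
proof -
  define p q a e D S where "p = d x u" "q = d x v" "a = d u w" "e = d u v" "D = d w v"
    "S = p + (1 - l) * a"
  note defs = this
  have nn: "p \<ge> 0" "q \<ge> 0" "a \<ge> 0" "e \<ge> 0" "D \<ge> 0" "1 - l \<ge> 0" "l \<ge> 0" using l by (auto simp: defs)
  have um: "(d m u)\<^sup>2 \<le> (1 - l) * a\<^sup>2 + l * e\<^sup>2 - l * (1 - l) * D\<^sup>2"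
    using m(1) unfolding cn_def defs by (simp add: commute[of m u])
  consider "p = 0" | "a = 0" | "l = 1" | "p > 0" "a > 0" "l < 1" using nn by fastforce
  then show ?thesis
  proof cases
    case 1
    then have "x = u" using M by (simp add: defs)
    then show ?thesis using m by simp
  next
    case 2
    then have uw: "u = w" using M by (simp add: defs)
    then have "e = D" by (simp add: defs)
    obtain s where s: "s \<in> M" "cn x u v l s" "cn m u v l s" using seg[OF l] by blast
    have "(d m s)\<^sup>2 \<le> (1 - l) * (d m u)\<^sup>2 + l * ((1 - l) * D)\<^sup>2 - l * (1 - l) * D\<^sup>2"
      using s(3) m(2) uw unfolding cn_def by (simp add: defs)
    also have "\<dots> \<le> (1 - l) * (l * e\<^sup>2 - l * (1 - l) * D\<^sup>2) + l * ((1 - l) * D)\<^sup>2 - l * (1 - l) * D\<^sup>2"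
      using um 2 nn by (intro add_right_mono diff_right_mono mult_left_mono) auto
    also have "\<dots> = 0" unfolding \<open>e = D\<close> by algebra
    finally have "m = s" using M s by simp
    then show ?thesis using s uw by simp
  next
    case 3
    then have "m = v" using m M by simp
    then show ?thesis using 3 by (simp add: cn_def)
  next
    case 4
    have S: "S > 0" using 4 by (simp add: defs add_pos_pos)
    \<comment> \<open>With \<open>x\<close> as origin, \<open>u\<close> is
      \<open>p / (p + a)\<close> times \<open>w\<close>; comparing coefficients of \<open>w\<close>
      and \<open>v\<close> in (1 - t) u + t v and a multiple of (1 - l) w + l v gives this
      \<open>t\<close>. The multiple is \<open>p / S\<close>, the fraction of [x, m] before the
      crossing.\<close>
    define t where "t = l * p / S"
    have t1: "1 - t = (1 - l) * (p + a) / S" using S by (simp add: t_def field_simps) (simp add: defs algebra_simps)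
    have t: "t \<in> {0..1}"
    proof -
      have "t \<ge> 0" using nn S by (simp add: t_def)
      moreover have "1 - t \<ge> 0" unfolding t1 using nn S by simp
      ultimately show ?thesis by simp
    qed
    obtain s where s: "s \<in> M" "cn x u v t s" "cn m u v t s" using seg[OF t] by blast
    define f g where "f = d m s" "g = d x s"
    note fg = this
    have f: "f\<^sup>2 \<le> (1 - t) * ((1 - l) * a\<^sup>2 + l * e\<^sup>2 - l * (1 - l) * D\<^sup>2) + t * ((1 - l) * D)\<^sup>2 - t * (1 - t) * e\<^sup>2"
    proof -
      have "f\<^sup>2 \<le> (1 - t) * (d m u)\<^sup>2 + t * ((1 - l) * D)\<^sup>2 - t * (1 - t) * e\<^sup>2"
        using s(3) m(2) unfolding cn_def fg by (simp add: defs)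
      also have "\<dots> \<le> (1 - t) * ((1 - l) * a\<^sup>2 + l * e\<^sup>2 - l * (1 - l) * D\<^sup>2) + t * ((1 - l) * D)\<^sup>2 - t * (1 - t) * e\<^sup>2"
        using um t by (intro add_right_mono diff_right_mono mult_left_mono) auto
      finally show ?thesis .
    qed
    have g: "g\<^sup>2 \<le> (1 - t) * p\<^sup>2 + t * q\<^sup>2 - t * (1 - t) * e\<^sup>2"
      using s(2) unfolding cn_def fg by (simp add: defs)
    have "(d x m)\<^sup>2 \<le> (f + g)\<^sup>2"
      using triangle[of x s m] s M by (intro power_mono) (auto simp: fg commute)
    also have "\<dots> \<le> S * (f\<^sup>2 / ((1 - l) * a)) + S * (g\<^sup>2 / p)"
    proof -
      define k where "k = (1 - l) * a"
      have k: "k > 0" using 4 by (simp add: k_def)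
      have "S * (f\<^sup>2 / k) + S * (g\<^sup>2 / p) - (f + g)\<^sup>2 = (p * f - k * g)\<^sup>2 / (k * p)"
        unfolding defs(6) k_def[symmetric] using k 4 by (simp add: field_simps power2_eq_square)
      moreover have "\<dots> \<ge> 0" using k 4 by simp
      ultimately show ?thesis unfolding k_def by linarith
    qed
    also have "\<dots> \<le> (1 - l) * (p + a)\<^sup>2 + l * q\<^sup>2 - l * (1 - l) * D\<^sup>2"
    proof -
      have "S * (f\<^sup>2 / ((1 - l) * a)) \<le> S * (((1 - t) * ((1 - l) * a\<^sup>2 + l * e\<^sup>2 - l * (1 - l) * D\<^sup>2) + t * ((1 - l) * D)\<^sup>2 - t * (1 - t) * e\<^sup>2) / ((1 - l) * a))"
        using f S 4 by (intro mult_left_mono divide_right_mono) auto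
      also have "\<dots> = (p + a) * (1 - l) * a + l * (p + a) * (1 - l) * e\<^sup>2 / S - l * (1 - l) * D\<^sup>2"
      proof -
        have "S * t = l * p" "S * (1 - t) = (1 - l) * (p + a)" using S by (simp_all only: t1) (simp_all add: t_def)
        have "S * ((1 - t) * ((1 - l) * a\<^sup>2 + l * e\<^sup>2 - l * (1 - l) * D\<^sup>2) + t * ((1 - l) * D)\<^sup>2 - t * (1 - t) * e\<^sup>2)
           = (S * (1 - t)) * ((1 - l) * a\<^sup>2 + l * e\<^sup>2 - l * (1 - l) * D\<^sup>2) + (S * t) * ((1 - l) * D)\<^sup>2 - t * (S * (1 - t)) * e\<^sup>2"
          by algebra
        also have "\<dots> = ((1 - l) * (p + a)) * ((1 - l) * a\<^sup>2 + l * e\<^sup>2 - l * (1 - l) * D\<^sup>2) + (l * p) * ((1 - l) * D)\<^sup>2 - l * p / S * ((1 - l) * (p + a)) * e\<^sup>2"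
          unfolding \<open>S * t = l * p\<close> \<open>S * (1 - t) = _\<close> by (simp add: t_def)
        \<comment> \<open>\<open>S\<close> is treated as an independent quantity when denominators
          are cleared; its definition enters only through the last summand, which it makes
          vanish.\<close>
        also have "\<dots> = ((1 - l) * a) * ((p + a) * (1 - l) * a + l * (p + a) * (1 - l) * e\<^sup>2 / S - l * (1 - l) * D\<^sup>2)
            + (1 - l) * (p + a) * l * e\<^sup>2 * ((S - p - (1 - l) * a) / S)"
          using S by (simp add: field_simps power2_eq_square)
        also have "(S - p - (1 - l) * a) / S = 0" by (simp add: defs)
        finally show ?thesis using 4 S by simp
      qed
      finally have F: "S * (f\<^sup>2 / ((1 - l) * a)) \<le> \<dots>" .
      have "S * (g\<^sup>2 / p) \<le> S * (((1 - t) * p\<^sup>2 + t * q\<^sup>2 - t * (1 - t) * e\<^sup>2) / p)"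
        using g S 4 by (intro mult_left_mono divide_right_mono) auto
      also have "\<dots> = (1 - l) * (p + a) * p + l * q\<^sup>2 - l * (1 - l) * (p + a) * e\<^sup>2 / S"
        unfolding t1 unfolding t_def using S 4 by (simp add: field_simps power2_eq_square)
      finally have G: "S * (g\<^sup>2 / p) \<le> \<dots>" .
      have "(1 - l) * (p + a)\<^sup>2 + l * q\<^sup>2 - l * (1 - l) * D\<^sup>2
        = ((p + a) * (1 - l) * a + l * (p + a) * (1 - l) * e\<^sup>2 / S - l * (1 - l) * D\<^sup>2)
          + ((1 - l) * (p + a) * p + l * q\<^sup>2 - l * (1 - l) * (p + a) * e\<^sup>2 / S)"
        using S by (simp add: field_simps power2_eq_square)
      then show ?thesis using F G by linarith
    qed
    finally show ?thesis unfolding cn_def xw by (simp add: defs)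
  qed
qed

text \<open>
  Letting the point of \<open>[u, v]\<close> tend to \<open>u\<close> compares the two angles at \<open>u\<close>: they add up to at least
  \<open>\<pi>\<close>, because \<open>u\<close> lies between \<open>x\<close> and \<open>w\<close>.
\<close>

lemma cn_at_crossing:
  assumes M: "x \<in> M" "u \<in> M" "v \<in> M" "w \<in> M"
    and seg: "\<And>t. t \<in> {0..1} \<Longrightarrow> \<exists>s\<in>M. cn x u v t s \<and> cn w u v t s"
    and xw: "d x w = d x u + d u w"
  shows "(d x u + d u w) * (d v u)\<^sup>2
    \<le> d x u * (d v w)\<^sup>2 + d u w * (d v x)\<^sup>2 - d x u * d u w * (d x u + d u w)"
proof -
  define p q a e D where "p = d x u" "q = d x v" "a = d u w" "e = d u v" "D = d w v"
  note defs = this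
  have com: "d v u = e" "d v w = D" "d v x = q" "d x u = p" "d u w = a" by (simp_all add: defs commute)
  have nn: "p \<ge> 0" "a \<ge> 0" by (auto simp: defs)
  consider "p = 0" | "a = 0" | "p > 0" "a > 0" using nn by fastforce
  then show ?thesis
  proof cases
    case 1
    then have "x = u" using M by (simp add: defs)
    then show ?thesis unfolding com using 1 by (simp add: defs)
  next
    case 2
    then have "u = w" using M by (simp add: defs)
    then show ?thesis unfolding com using 2 by (simp add: defs)
  next
    case 3
    \<comment> \<open>By the law of cosines \<open>X\<close> is \<open>- 2 * e\<close> times the sum
      of the cosines of the two comparison angles at \<open>u\<close>, so \<open>X \<ge> 0\<close>
      says that they add up to at least \<pi>. \<open>Y\<close> collects the terms of second order
      in \<open>t\<close>.\<close>
    define X where "X = (D\<^sup>2 - a\<^sup>2 - e\<^sup>2) / a + (q\<^sup>2 - p\<^sup>2 - e\<^sup>2) / p"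
    define Y where "Y = e\<^sup>2 / a + e\<^sup>2 / p"
    have XY: "- X \<le> t * Y" if t: "t \<in> {0<..1}" for t
    proof -
      obtain s where s: "s \<in> M" "cn x u v t s" "cn w u v t s" using seg[of t] t by auto
      define f g where "f = d w s" "g = d x s"
      note fg = this
      have f: "f\<^sup>2 \<le> (1 - t) * a\<^sup>2 + t * D\<^sup>2 - t * (1 - t) * e\<^sup>2"
        using s(3) unfolding cn_def fg by (simp add: defs commute[of w u])
      have g: "g\<^sup>2 \<le> (1 - t) * p\<^sup>2 + t * q\<^sup>2 - t * (1 - t) * e\<^sup>2"
        using s(2) unfolding cn_def fg by (simp add: defs)
      have "p + a \<le> f + g"
        using triangle[of x s w] s M xw by (simp add: fg defs commute)
      then have "(p + a)\<^sup>2 \<le> (f + g)\<^sup>2" using 3 by (intro power_mono) auto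
      also have "\<dots> \<le> (p + a) * (f\<^sup>2 / a + g\<^sup>2 / p)"
      proof -
        have "(p + a) * (f\<^sup>2 / a + g\<^sup>2 / p) - (f + g)\<^sup>2 = (p * f - a * g)\<^sup>2 / (a * p)"
          using 3 by (simp add: field_simps power2_eq_square)
        moreover have "\<dots> \<ge> 0" using 3 by simp
        ultimately show ?thesis by linarith
      qed
      finally have "p + a \<le> f\<^sup>2 / a + g\<^sup>2 / p"
        using 3 by (simp add: power2_eq_square[of "p + a"])
      also have "\<dots> \<le> ((1 - t) * a\<^sup>2 + t * D\<^sup>2 - t * (1 - t) * e\<^sup>2) / a
          + ((1 - t) * p\<^sup>2 + t * q\<^sup>2 - t * (1 - t) * e\<^sup>2) / p"
        using f g 3 by (intro add_mono divide_right_mono) auto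
      also have "\<dots> = p + a + t * (X + t * Y)"
        unfolding X_def Y_def using 3 by (simp add: field_simps power2_eq_square)
      finally have "0 \<le> t * (X + t * Y)" by simp
      then show ?thesis using t by (simp add: zero_le_mult_iff)
    qed
    have "X \<ge> 0"
    proof (rule ccontr)
      assume "\<not> X \<ge> 0"
      then have X: "X < 0" by simp
      have "Y \<ge> 0" using 3 by (simp add: Y_def)
      \<comment> \<open>Small enough that \<open>t * Y\<close> is at most half of
        \<open>- X\<close>; the summand 1 covers \<open>Y = 0\<close>.\<close>
      define t where "t = min 1 (- X / (2 * (Y + 1)))"
      have "- X / (2 * (Y + 1)) > 0" using X \<open>Y \<ge> 0\<close> by (intro divide_pos_pos) auto
      then have t: "t \<in> {0<..1}" by (auto simp: t_def)
      have "t * Y \<le> - X / (2 * (Y + 1)) * (Y + 1)"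
        using X \<open>Y \<ge> 0\<close> t by (intro mult_mono) (auto simp: t_def)
      also have "\<dots> = - X / 2" using \<open>Y \<ge> 0\<close> by (simp add: field_simps)
      finally show False using XY[OF t] X by simp
    qed
    then have "0 \<le> a * p * X" using 3 by simp
    also have "a * p * X = p * (D\<^sup>2 - a\<^sup>2 - e\<^sup>2) + a * (q\<^sup>2 - p\<^sup>2 - e\<^sup>2)"
      unfolding X_def using 3 by (simp add: field_simps)
    finally show ?thesis unfolding com by (simp add: algebra_simps power2_eq_square)
  qed
qed

text \<open>Convexity of \<open>C\<close> in \<open>X\<close>: the point that \<open>X\<close>
  provides for \<open>u\<close>, \<open>v\<close> is determined by its distances to them, and
  \<open>s\<close> has these distances. Hence \<open>s\<close> also serves for test points outside
  \<open>C\<close>.\<close>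

lemma CN_point_of_part:
  assumes "CN X" "X \<subseteq> M" "C \<subseteq> X" "CN C" "u \<in> C" "v \<in> C" "t \<in> {0..1}"
    and s: "s \<in> C" "\<And>x. x \<in> C \<Longrightarrow> cn x u v t s" and x: "x \<in> X"
  shows "cn x u v t s"
proof -
  obtain s' where s': "s' \<in> X" "\<And>x. x \<in> X \<Longrightarrow> cn x u v t s'"
    using CN_point[of X u v t] assms by blast
  have "d u s = t * d u v" "d s v = (1 - t) * d u v"
    using cn_between[of u v s t] assms by auto
  then have "s = s'" using s' s assms by (intro cn_unique[of s' s u v t]) auto
  then show ?thesis using s' x by simp
qed

text \<open>
  For \<open>x\<close> in \<open>Y\<close>, the triangle \<open>x\<close>, \<open>y\<close>, \<open>z\<close> is cut at the points \<open>b\<close>, \<open>c\<close> where its sides from \<open>x\<close>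
  leave \<open>Y\<close>: the inequality passes from \<open>[b, c]\<close> to \<open>[y, c]\<close> and from there to \<open>[y, z]\<close>.
\<close>

lemma cn_from_other_side:
  assumes sub: "X \<subseteq> M" "Y \<subseteq> M" and CN: "CN X" "CN Y" "CN (X \<inter> Y)"
    and sep: "\<And>x y. x \<in> X \<Longrightarrow> y \<in> Y \<Longrightarrow> \<exists>c\<in>X \<inter> Y. d x y = d x c + d c y"
    and yz: "y \<in> X" "z \<in> X" and l: "l \<in> {0..1}"
    and m: "m \<in> X" "\<And>x. x \<in> X \<Longrightarrow> cn x y z l m" and x: "x \<in> X \<union> Y"
  shows "cn x y z l m"
proof (cases "x \<in> X")
  case False
  then have xY: "x \<in> Y" using x by simp
  have between: "d m z = (1 - l) * d y z"
    if "y \<in> X" "z \<in> X" "l \<in> {0..1}" "m \<in> X" "\<And>x. x \<in> X \<Longrightarrow> cn x y z l m" for y z l m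
    using cn_between[of y z m l] that sub by auto
  obtain b where b: "b \<in> X" "b \<in> Y" "d x y = d x b + d b y"
    using sep[OF yz(1) xY] by (auto simp: commute add.commute)
  obtain c where c: "c \<in> X" "c \<in> Y" "d x z = d x c + d c z"
    using sep[OF yz(2) xY] by (auto simp: commute add.commute)
  have part: "cn x y c t k" if t: "t \<in> {0..1}" and k: "k \<in> X" "\<And>x. x \<in> X \<Longrightarrow> cn x y c t k" for t k
  proof (rule cn_through_segment[where u = b])
    fix r :: real assume r: "r \<in> {0..1}"
    obtain s where s: "s \<in> X \<inter> Y" "\<And>x. x \<in> X \<inter> Y \<Longrightarrow> cn x b c r s"
      using CN_point[OF CN(3) _ _ r, of b c] b c by blast
    have "cn x b c r s" "cn k b c r s"
      using CN_point_of_part[of Y "X \<inter> Y" b c r s x] CN_point_of_part[of X "X \<inter> Y" b c r s k]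
        s CN sub b c r xY k by auto
    then show "\<exists>s\<in>M. cn x b c r s \<and> cn k b c r s" using s sub by blast
  qed (use sub b c yz k t xY between[OF yz(1) c(1) t k] in auto)
  \<comment> \<open>The ends are exchanged so that the cut \<open>c\<close> on [x, z] takes the
    place of \<open>u\<close>; this turns \<open>l\<close> into \<open>1 - l\<close>.\<close>
  have "cn x z y (1 - l) m"
  proof (rule cn_through_segment[where u = c])
    show "d m y = (1 - (1 - l)) * d z y"
      using cn_between(1)[of y z m l] m yz sub l by (auto simp: commute)
  next
    fix r :: real assume r: "r \<in> {0..1}"
    obtain s where s: "s \<in> X" "\<And>x. x \<in> X \<Longrightarrow> cn x c y r s"
      using CN_point[OF CN(1) c(1) yz(1) r] by blast
    have "cn x y c (1 - r) s"
      using s r by (intro part) (auto simp: cn_swap[of _ c])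
    then show "\<exists>s\<in>M. cn x c y r s \<and> cn m c y r s"
      using s m(1) sub by (auto simp: cn_swap[of _ c])
  qed (use sub c yz m l xY in \<open>auto simp: cn_swap[of _ z]\<close>)
  then show ?thesis by (simp add: cn_swap[of x y])
qed (use m in auto)

text \<open>The wanted point lies on the part [y, c] of the broken geodesic, inside
  \<open>X\<close>, where \<open>CN\<close> supplies it. Its inequality involves
  \<open>d x c\<close>, which is then bounded by the inequality at the crossing point
  \<open>c\<close>.\<close>

lemma CN_Un_half:
  assumes sub: "X \<subseteq> M" "Y \<subseteq> M" and CN: "CN X" "CN Y" "CN (X \<inter> Y)"
    and sep: "\<And>x y. x \<in> X \<Longrightarrow> y \<in> Y \<Longrightarrow> \<exists>c\<in>X \<inter> Y. d x y = d x c + d c y"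
    and yz: "y \<in> X" "z \<in> Y" and c: "c \<in> X" "c \<in> Y" "d y z = d y c + d c z"
    and l: "l \<in> {0..1}" "l * d y z \<le> d y c"
  shows "\<exists>m\<in>X \<union> Y. \<forall>x\<in>X \<union> Y. cn x y z l m"
proof -
  have sep': "\<exists>c\<in>Y \<inter> X. d y x = d y c + d c x" if "x \<in> X" "y \<in> Y" for x y
    using sep[OF that] by (auto simp: commute add.commute)
  \<comment> \<open>\<open>k\<close> is the parameter on [y, c] of the point at distance
    \<open>l * L\<close> from \<open>y\<close>. If \<open>a = 0\<close>, then
    \<open>l * L = 0\<close>, and \<open>k = 0\<close> by division by zero.\<close>
  define a L k where "a = d y c" "L = d y z" "k = l * L / a"
  have "0 \<le> l * L" "l * L \<le> a" using l by (auto simp: a_L_k_def)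
  then have k: "k \<in> {0..1}" "k * a = l * L"
    by (auto simp: a_L_k_def(3) divide_simps)
  obtain m where m: "m \<in> X" "\<And>x. x \<in> X \<Longrightarrow> cn x y c k m"
    using CN_point[OF CN(1) yz(1) c(1) k(1)] by blast
  have "cn x y z l m" if x: "x \<in> X \<union> Y" for x
  proof -
    have m': "cn x y c k m"
      using cn_from_other_side[OF sub CN sep yz(1) c(1) k(1) m x] by blast
    \<comment> \<open>The segment [c, x] lies in one of the two pieces, and
      \<open>cn_from_other_side\<close> admits the end of [y, z] in the other piece as a test
      point.\<close>
    have "\<exists>s\<in>M. cn z c x t s \<and> cn y c x t s" if t: "t \<in> {0..1}" for t
    proof (cases "x \<in> X")
      case True
      obtain s where s: "s \<in> X" "\<And>w. w \<in> X \<Longrightarrow> cn w c x t s"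
        using CN_point[OF CN(1) c(1) True t] by blast
      then show ?thesis
        using cn_from_other_side[OF sub CN sep c(1) True t s] yz sub by blast
    next
      case False
      then have xY: "x \<in> Y" using x by simp
      obtain s where s: "s \<in> Y" "\<And>w. w \<in> Y \<Longrightarrow> cn w c x t s"
        using CN_point[OF CN(2) c(2) xY t] by blast
      have "CN (Y \<inter> X)" using CN(3) by (simp add: Int_commute)
      then show ?thesis
        using cn_from_other_side[OF sub(2,1) CN(2,1) _ sep' c(2) xY t s] yz sub s by blast
    qed
    then have "(d z c + d c y) * (d x c)\<^sup>2
      \<le> d z c * (d x y)\<^sup>2 + d c y * (d x z)\<^sup>2 - d z c * d c y * (d z c + d c y)"
      using yz c sub x by (intro cn_at_crossing) (auto simp: commute add.commute)
    \<comment> \<open>The inequality for \<open>c\<close> as the point of [y, z] with parameter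
      \<open>a / L\<close>, multiplied by \<open>L\<close>.\<close>
    then have at_c: "L * (d x c)\<^sup>2 \<le> (L - a) * (d x y)\<^sup>2 + a * (d x z)\<^sup>2 - (L - a) * a * L"
      using c(3) by (simp add: a_L_k_def commute add.commute)
    show ?thesis
    proof (cases "L = 0")
      case True
      then have "d y z = 0" "d y c = 0" using c(3) by (auto simp: a_L_k_def add_nonneg_eq_0_iff)
      moreover have "y \<in> M" "z \<in> M" "c \<in> M" using yz c sub by auto
      ultimately have "y = z" "y = c" "d z z = 0" by simp_all
      then show ?thesis using m' by (simp add: cn_def algebra_simps)
    next
      case False
      then have L: "L > 0" by (simp add: a_L_k_def order_less_le)
      have "L * (d x m)\<^sup>2 \<le> L * ((1 - k) * (d x y)\<^sup>2 + k * (d x c)\<^sup>2 - k * (1 - k) * a\<^sup>2)"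
        using m' L unfolding cn_def a_L_k_def(1)[symmetric] by (intro mult_left_mono) auto
      also have "\<dots> = L * (1 - k) * (d x y)\<^sup>2 + k * (L * (d x c)\<^sup>2) - L * (k * (1 - k) * a\<^sup>2)"
        by (simp add: algebra_simps)
      also have "\<dots> \<le> L * (1 - k) * (d x y)\<^sup>2
          + k * ((L - a) * (d x y)\<^sup>2 + a * (d x z)\<^sup>2 - (L - a) * a * L) - L * (k * (1 - k) * a\<^sup>2)"
        using at_c k by (intro add_left_mono diff_right_mono mult_left_mono) auto
      also have "\<dots> = (L - k * a) * (d x y)\<^sup>2 + k * a * (d x z)\<^sup>2 - k * a * (L - k * a) * L"
        by algebra
      also have "\<dots> = L * ((1 - l) * (d x y)\<^sup>2 + l * (d x z)\<^sup>2 - l * (1 - l) * L\<^sup>2)"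
        unfolding k(2) by algebra
      finally show ?thesis using L unfolding cn_def by (simp add: a_L_k_def(2))
    qed
  qed
  then show ?thesis using m by blast
qed

theorem CN_Un:
  assumes sub: "X \<subseteq> M" "Y \<subseteq> M" and CN: "CN X" "CN Y" "CN (X \<inter> Y)"
    and sep: "\<And>x y. x \<in> X \<Longrightarrow> y \<in> Y \<Longrightarrow> \<exists>c\<in>X \<inter> Y. d x y = d x c + d c y"
  shows "CN (X \<union> Y)"
proof -
  have CN': "CN (Y \<inter> X)" using CN(3) by (simp add: Int_commute)
  have sep': "\<exists>c\<in>Y \<inter> X. d y x = d y c + d c x" if "y \<in> Y" "x \<in> X" for x y
    using sep[OF that(2,1)] by (auto simp: commute add.commute)
  have mixed: "\<exists>m\<in>X \<union> Y. \<forall>x\<in>X \<union> Y. cn x y z l m"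
    if yz: "y \<in> X" "z \<in> Y" and l: "l \<in> {0..1}" for y z l
  proof -
    obtain c where c: "c \<in> X" "c \<in> Y" "d y z = d y c + d c z" using sep[OF yz] by blast
    show ?thesis
    proof (cases "l * d y z \<le> d y c")
      case True
      then show ?thesis using CN_Un_half[OF sub CN sep yz c l] by blast
    next
      case False
      \<comment> \<open>The wanted point lies beyond \<open>c\<close>, hence before \<open>c\<close>
        as seen from \<open>z\<close>: the pieces and the ends are exchanged.\<close>
      then have "(1 - l) * d z y \<le> d z c" using c(3) by (simp add: commute algebra_simps)
      moreover have "d z y = d z c + d c y" using c(3) by (simp add: commute)
      ultimately have "\<exists>m\<in>Y \<union> X. \<forall>x\<in>Y \<union> X. cn x z y (1 - l) m"
        using l c by (intro CN_Un_half[OF sub(2,1) CN(2,1) CN' sep' yz(2,1)]) auto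
      then show ?thesis by (simp add: Un_commute cn_swap[of _ y])
    qed
  qed
  have pure: "\<exists>m\<in>X \<union> Y. \<forall>x\<in>X \<union> Y. cn x y z l m"
    if yzl: "y \<in> X" "z \<in> X" "l \<in> {0..1}" for y z l
  proof -
    obtain m where "m \<in> X" "\<And>x. x \<in> X \<Longrightarrow> cn x y z l m"
      using CN_point[OF CN(1) yzl] by blast
    then show ?thesis using cn_from_other_side[OF sub CN sep yzl] by blast
  qed
  have pure': "\<exists>m\<in>X \<union> Y. \<forall>x\<in>X \<union> Y. cn x y z l m"
    if yzl: "y \<in> Y" "z \<in> Y" "l \<in> {0..1}" for y z l
  proof -
    obtain m where "m \<in> Y" "\<And>x. x \<in> Y \<Longrightarrow> cn x y z l m"
      using CN_point[OF CN(2) yzl] by blast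
    then show ?thesis using cn_from_other_side[OF sub(2,1) CN(2,1) CN' sep' yzl] by blast
  qed
  have mixed': "\<exists>m\<in>X \<union> Y. \<forall>x\<in>X \<union> Y. cn x y z l m"
    if "y \<in> Y" "z \<in> X" "l \<in> {0..1}" for y z l
    using mixed[of z y "1 - l"] that by (auto simp: cn_swap[of _ y])
  show ?thesis unfolding CN_def using mixed mixed' pure pure' by blast
qed

end

section \<open>The cubes of a distributive lattice of integer vectors\<close>

text \<open>Vectors are functions on the whole index type with the pointwise order;
  \<open>off\<close> makes the entries in \<open>I\<close> determine them. \<open>accessible\<close>
  says that one climbs from \<open>a\<close> to \<open>b\<close> by unit steps inside
  \<open>V\<close>. It yields connectedness and the next coordinate to cut at.\<close>

locale cubed_lattice =
  fixes V :: "('i \<Rightarrow> int) set" and I :: "'i set"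
  assumes fin_I: "finite I" and fin_V: "finite V"
    and off: "\<And>v i. v \<in> V \<Longrightarrow> i \<notin> I \<Longrightarrow> v i = 0"
    and sup_V: "\<And>a b. a \<in> V \<Longrightarrow> b \<in> V \<Longrightarrow> sup a b \<in> V"
    and inf_V: "\<And>a b. a \<in> V \<Longrightarrow> b \<in> V \<Longrightarrow> inf a b \<in> V"
    and accessible: "\<And>a b. a \<in> V \<Longrightarrow> b \<in> V \<Longrightarrow> a \<le> b \<Longrightarrow> a \<noteq> b \<Longrightarrow>
      \<exists>i. a i < b i \<and> a(i := a i + 1) \<in> V"
begin

definition is_cube :: "('i \<Rightarrow> int) \<Rightarrow> ('i \<Rightarrow> int) \<Rightarrow> bool" where
  "is_cube l u \<longleftrightarrow> l \<le> u \<and> (\<forall>i. u i \<le> l i + 1) \<and> {l..u} \<subseteq> V"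

definition box :: "('i \<Rightarrow> int) \<Rightarrow> ('i \<Rightarrow> int) \<Rightarrow> ('i \<Rightarrow> real) set" where
  "box l u = {x. \<forall>i. of_int (l i) \<le> x i \<and> x i \<le> of_int (u i)}"

text \<open>Only cubes inside the interval count, so this is in general smaller than
  \<open>box a b\<close>.\<close>

definition pts :: "('i \<Rightarrow> int) \<Rightarrow> ('i \<Rightarrow> int) \<Rightarrow> ('i \<Rightarrow> real) set" where
  "pts a b = \<Union> {box l u | l u. is_cube l u \<and> a \<le> l \<and> u \<le> b}"

definition points :: "('i \<Rightarrow> real) set" where
  "points = \<Union> {box l u | l u. is_cube l u}"

definition edist :: "('i \<Rightarrow> real) \<Rightarrow> ('i \<Rightarrow> real) \<Rightarrow> real" where
  "edist x y = L2_set (\<lambda>i. x i - y i) I"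

text \<open>Mirrors \<open>pl_path\<close>, and \<open>cdist\<close> mirrors \<open>pl_dist\<close>
  including the dummy 0, so that distances can be carried over as equalities.\<close>

inductive path :: "('i \<Rightarrow> real) \<Rightarrow> ('i \<Rightarrow> real) \<Rightarrow> real \<Rightarrow> bool" where
  path_refl: "p \<in> points \<Longrightarrow> path p p 0"
| path_step: "is_cube l u \<Longrightarrow> p \<in> box l u \<Longrightarrow> q \<in> box l u \<Longrightarrow> path q r k \<Longrightarrow>
    path p r (edist p q + k)"

definition cdist :: "('i \<Rightarrow> real) \<Rightarrow> ('i \<Rightarrow> real) \<Rightarrow> real" where
  "cdist p q = (if \<exists>k. path p q k then Inf {k. path p q k} else 0)"

text \<open>The projection onto \<open>box a b\<close>. On integer vectors it is the lattice
  polynomial \<open>sup a (inf b x)\<close>, so it maps \<open>V\<close> into itself for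
  \<open>a\<close>, \<open>b\<close> in \<open>V\<close>.\<close>

definition clamp :: "('i \<Rightarrow> int) \<Rightarrow> ('i \<Rightarrow> int) \<Rightarrow> ('i \<Rightarrow> real) \<Rightarrow> 'i \<Rightarrow> real" where
  "clamp a b x i = max (of_int (a i)) (min (of_int (b i)) (x i))"

section \<open>The path metric on the union of the cubes\<close>

lemma is_cubeD:
  assumes "is_cube l u"
  shows "l \<in> V" "u \<in> V" "l \<le> u" "\<And>i. u i \<le> l i + 1" "\<And>v. l \<le> v \<Longrightarrow> v \<le> u \<Longrightarrow> v \<in> V"
  using assms unfolding is_cube_def by auto

lemma box_pts: "is_cube l u \<Longrightarrow> a \<le> l \<Longrightarrow> u \<le> b \<Longrightarrow> x \<in> box l u \<Longrightarrow> x \<in> pts a b"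
  unfolding pts_def by blast

lemma ptsE:
  assumes "x \<in> pts a b"
  obtains l u where "is_cube l u" "a \<le> l" "u \<le> b" "x \<in> box l u"
  using assms unfolding pts_def by blast

lemma pts_subset: "pts a b \<subseteq> points"
  unfolding pts_def points_def by blast

lemma box_points: "is_cube l u \<Longrightarrow> box l u \<subseteq> points"
  unfolding points_def by blast

lemma pointsE:
  assumes "x \<in> points"
  obtains l u where "is_cube l u" "x \<in> box l u"
  using assms unfolding points_def by blast

lemma box_off: "is_cube l u \<Longrightarrow> x \<in> box l u \<Longrightarrow> i \<notin> I \<Longrightarrow> x i = 0"
  using is_cubeD(1,2)[of l u] off unfolding box_def by (metis (mono_tags, lifting) mem_Collect_eq of_int_0 order_antisym)

lemma points_off: "x \<in> points \<Longrightarrow> i \<notin> I \<Longrightarrow> x i = 0"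
  using box_off by (blast elim: pointsE)

lemma edist_nonneg [simp]: "0 \<le> edist x y"
  by (simp add: edist_def)

lemma edist_self [simp]: "edist x x = 0"
  by (simp add: edist_def L2_set_def)

lemma edist_commute: "edist x y = edist y x"
  unfolding edist_def L2_set_def by (simp add: power2_commute)

lemma edist_triangle: "edist x z \<le> edist x y + edist y z"
  using L2_set_triangle_ineq[of "\<lambda>i. x i - y i" "\<lambda>i. y i - z i" I] by (simp add: edist_def)

lemma edist_eq_0:
  assumes "x \<in> points" "y \<in> points" "edist x y = 0"
  shows "x = y"
proof
  fix i show "x i = y i"
    using assms points_off[of x i] points_off[of y i] fin_I
    by (cases "i \<in> I") (auto simp: edist_def L2_set_eq_0_iff)
qed

lemma path_points:
  assumes "path p q k"
  shows "p \<in> points" "q \<in> points"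
  using assms by (induction) (use box_points in auto)

lemma path_trans: "path p q k \<Longrightarrow> path q r k' \<Longrightarrow> path p r (k + k')"
  by (induction rule: path.induct) (auto simp: add.assoc intro: path_step)

lemma path_cube: "is_cube l u \<Longrightarrow> p \<in> box l u \<Longrightarrow> q \<in> box l u \<Longrightarrow> path p q (edist p q)"
  using path_step[of l u p q q 0] path_refl[of q] box_points by auto

lemma path_sym: "path p q k \<Longrightarrow> path q p k"
proof (induction rule: path.induct)
  case (path_step l u p q r k)
  then have "path q p (edist p q)" using path_cube edist_commute by metis
  then have "path r p (k + edist p q)" by (rule path_trans[OF path_step.IH])
  then show ?case by (simp add: add.commute)
qed (rule path_refl)

lemma edist_le_path: "path p q k \<Longrightarrow> edist p q \<le> k"
proof (induction rule: path.induct)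
  case (path_step l u p q r k)
  then show ?case using edist_triangle[of p r q] by simp
qed simp

lemma path_nonneg: "path p q k \<Longrightarrow> 0 \<le> k"
  using edist_le_path edist_nonneg order_trans by blast

lemma vertex_path:
  assumes "a \<in> V" "b \<in> V" "a \<le> b"
  shows "\<exists>k. path (of_int \<circ> a) (of_int \<circ> b) k"
  using assms
proof (induction "card {v \<in> V. a \<le> v}" arbitrary: a rule: less_induct)
  case less
  show ?case
  proof (cases "a = b")
    case True
    have "is_cube a a" using less.prems by (simp add: is_cube_def)
    then have "of_int \<circ> a \<in> points" using box_points by (force simp: box_def)
    then show ?thesis using True path_refl by blast
  next
    case False
    obtain i where i: "a i < b i" "a(i := a i + 1) \<in> V"
      using accessible less.prems False by blast
    define a' where "a' = a(i := a i + 1)"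
    have le: "a \<le> a'" "a' \<le> b" "a' \<in> V" using i less.prems by (auto simp: a'_def le_fun_def)
    have cube: "is_cube a a'"
      unfolding is_cube_def
    proof (intro conjI allI subsetI)
      show "a' j \<le> a j + 1" for j by (simp add: a'_def)
      fix v assume "v \<in> {a..a'}"
      then have *: "a j \<le> v j" "v j \<le> a' j" for j by (auto simp: le_fun_def)
      have "v j = a j" if "j \<noteq> i" for j using *[of j] that by (simp add: a'_def)
      moreover have "v i = a i \<or> v i = a' i" using *[of i] by (auto simp: a'_def)
      ultimately have "v = a \<or> v = a'" unfolding a'_def fun_eq_iff by (metis fun_upd_apply)
      then show "v \<in> V" using le less.prems by auto
    qed (use le in auto)
    have "a' i = a i + 1" by (simp add: a'_def)
    then have "\<not> a' \<le> a" by (metis add_le_same_cancel1 le_fun_def not_one_le_zero)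
    then have "a \<in> {v \<in> V. a \<le> v} - {v \<in> V. a' \<le> v}" using less.prems by simp
    moreover have "{v \<in> V. a' \<le> v} \<subseteq> {v \<in> V. a \<le> v}" using le by (auto intro: order_trans)
    ultimately have "{v \<in> V. a' \<le> v} \<subset> {v \<in> V. a \<le> v}" by blast
    then have "card {v \<in> V. a' \<le> v} < card {v \<in> V. a \<le> v}"
      using fin_V by (intro psubset_card_mono) auto
    then obtain k where k: "path (of_int \<circ> a') (of_int \<circ> b) k"
      using less.hyps le less.prems by blast
    have "of_int \<circ> a \<in> box a a'" "of_int \<circ> a' \<in> box a a'"
      using le by (auto simp: box_def le_fun_def)
    then show ?thesis using path_step[OF cube _ _ k] by blast
  qed
qed

text \<open>Each point is joined to the lowest corner of a cube containing it, and two such corners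
  are both reached by climbing from their infimum.\<close>

lemma path_exists:
  assumes "x \<in> points" "y \<in> points"
  shows "\<exists>k. path x y k"
proof -
  have vertex: "\<exists>l\<in>V. \<exists>k. path x (of_int \<circ> l) k" if x: "x \<in> points" for x
  proof -
    obtain l u where "is_cube l u" "x \<in> box l u" using pointsE[OF x] .
    moreover from this have "of_int \<circ> l \<in> box l u"
      using is_cubeD(3) by (auto simp: box_def le_fun_def)
    ultimately show ?thesis using path_cube is_cubeD(1) by blast
  qed
  obtain l l' k k' where l: "l \<in> V" "path x (of_int \<circ> l) k" "l' \<in> V" "path y (of_int \<circ> l') k'"
    using vertex assms by meson
  have "\<exists>k. path (of_int \<circ> inf l l') (of_int \<circ> l) k" "\<exists>k. path (of_int \<circ> inf l l') (of_int \<circ> l') k"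
    using l inf_V by (auto intro!: vertex_path)
  then show ?thesis using l by (meson path_sym path_trans)
qed

lemma cdist_path:
  assumes "path p q k"
  shows "cdist p q \<le> k"
  using assms path_nonneg unfolding cdist_def
  by (auto intro!: cInf_lower bdd_belowI[of _ 0])

lemma le_cdist:
  assumes "p \<in> points" "q \<in> points" "\<And>k. path p q k \<Longrightarrow> c \<le> k"
  shows "c \<le> cdist p q"
  using path_exists[OF assms(1,2)] assms(3) unfolding cdist_def
  by (auto intro!: cInf_greatest)

text \<open>Distinct points have positive distance because the Euclidean distance bounds every path
  length from below.\<close>

lemma Metric_space_points: "Metric_space points cdist"
proof
  show "0 \<le> cdist x y" for x y
    unfolding cdist_def using path_nonneg by (auto intro!: cInf_greatest)
  have "path x y = path y x" for x y using path_sym by blast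
  then show "cdist x y = cdist y x" for x y by (simp add: cdist_def)
  fix x y assume xy: "x \<in> points" "y \<in> points"
  show "cdist x y = 0 \<longleftrightarrow> x = y"
  proof
    assume "cdist x y = 0"
    moreover have "edist x y \<le> cdist x y" using xy edist_le_path by (intro le_cdist)
    ultimately show "x = y" using edist_eq_0[OF xy] edist_nonneg[of x y] by simp
  next
    assume "x = y"
    moreover from this have "cdist x y \<le> 0" using xy path_refl by (intro cdist_path) auto
    ultimately show "cdist x y = 0" using \<open>0 \<le> cdist x y\<close> by simp
  qed
  fix z assume z: "z \<in> points"
  have "cdist x z - k \<le> cdist y z" if k: "path x y k" for k
    using cdist_path[OF path_trans[OF k]] by (intro le_cdist xy z) (simp add: algebra_simps)
  then have "cdist x z - cdist y z \<le> cdist x y"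
    by (intro le_cdist xy) (simp add: algebra_simps)
  then show "cdist x z \<le> cdist x y + cdist y z" by simp
qed

sublocale P: Metric_space points cdist
  by (rule Metric_space_points)

lemma cdist_cube:
  assumes "is_cube l u" "p \<in> box l u" "q \<in> box l u"
  shows "cdist p q = edist p q"
proof (rule order_antisym)
  show "cdist p q \<le> edist p q" using path_cube[OF assms] by (rule cdist_path)
  show "edist p q \<le> cdist p q"
    using assms box_points edist_le_path by (intro le_cdist) auto
qed

section \<open>Clamping to an interval and optimal crossing points\<close>

lemma cube_clamp:
  assumes "is_cube l u" "a \<in> V" "b \<in> V" "a \<le> b"
  shows "is_cube (sup a (inf b l)) (sup a (inf b u))"
    and "x \<in> box l u \<Longrightarrow> clamp a b x \<in> box (sup a (inf b l)) (sup a (inf b u))"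
    and "x \<in> box l u \<Longrightarrow> y \<in> box l u \<Longrightarrow> edist (clamp a b x) (clamp a b y) \<le> edist x y"
proof -
  note lu = is_cubeD[OF assms(1)]
  have le: "l i \<le> u i" "a i \<le> b i" for i using lu(3) assms(4) by (auto simp: le_fun_def)
  show "is_cube (sup a (inf b l)) (sup a (inf b u))"
    unfolding is_cube_def
  proof (intro conjI allI subsetI)
    show "sup a (inf b l) \<le> sup a (inf b u)" using lu(3) by (meson inf_mono order_refl sup_mono)
    show "sup a (inf b u) i \<le> sup a (inf b l) i + 1" for i
      using lu(4)[of i] by (auto simp: sup_int_def inf_int_def)
    fix w assume w: "w \<in> {sup a (inf b l)..sup a (inf b u)}"
    \<comment> \<open>\<open>w\<close> is recovered by clamping to [a, b] the vertex
      \<open>sup l (inf u w)\<close> of the given cube, so it lies in \<open>V\<close> by closure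
      under \<open>sup\<close> and \<open>inf\<close>.\<close>
    have "w i = sup a (inf b (sup l (inf u w))) i" for i
    proof -
      have "sup a (inf b l) i \<le> w i" "w i \<le> sup a (inf b u) i"
        using w unfolding atLeastAtMost_iff le_fun_def by blast+
      then show ?thesis using le[of i] lu(4)[of i]
        by (simp add: sup_int_def inf_int_def max_def min_def split: if_splits)
    qed
    then have "w = sup a (inf b (sup l (inf u w)))" by blast
    moreover have "sup l (inf u w) \<in> V" using lu(3) by (intro lu(5)) auto
    ultimately show "w \<in> V" using sup_V inf_V assms(2,3) by metis
  qed
  show "clamp a b x \<in> box (sup a (inf b l)) (sup a (inf b u))" if "x \<in> box l u"
  proof -
    have "of_int (l i) \<le> x i" "x i \<le> of_int (u i)" for i using that by (auto simp: box_def)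
    then show ?thesis
      unfolding box_def clamp_def
      by (auto simp: sup_int_def inf_int_def of_int_max of_int_min intro: max.mono min.mono max.coboundedI2 min.coboundedI2)
  qed
  show "edist (clamp a b x) (clamp a b y) \<le> edist x y"
    unfolding edist_def L2_set_def
  proof (intro real_sqrt_le_mono sum_mono)
    fix i
    have "\<bar>clamp a b x i - clamp a b y i\<bar> \<le> \<bar>x i - y i\<bar>"
      by (auto simp: clamp_def max_def min_def)
    then show "(clamp a b x i - clamp a b y i)\<^sup>2 \<le> (x i - y i)\<^sup>2" by (rule abs_le_square_iff[THEN iffD1])
  qed
qed

lemma clamp_pts:
  assumes "a \<in> V" "b \<in> V" "a \<le> b" "x \<in> pts a b"
  shows "clamp a b x = x"
proof -
  obtain l u where "a \<le> l" "u \<le> b" "x \<in> box l u" using assms(4) by (auto elim: ptsE)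
  then have "of_int (a i) \<le> x i" "x i \<le> of_int (b i)" for i
    unfolding box_def le_fun_def by (metis (mono_tags, lifting) mem_Collect_eq of_int_le_iff order_trans)+
  then show ?thesis by (auto simp: clamp_def fun_eq_iff)
qed

lemma cdist_clamp_path:
  assumes ab: "a \<in> V" "b \<in> V" "a \<le> b" and "path p q k"
  shows "cdist (clamp a b p) (clamp a b q) \<le> k"
  using assms(4)
proof (induction rule: path.induct)
  case (path_refl p)
  then obtain l u where "is_cube l u" "p \<in> box l u" by (rule pointsE)
  then have "clamp a b p \<in> points" using cube_clamp[OF _ ab] box_points by blast
  then show ?case by simp
next
  case (path_step l u p q r k)
  have "r \<in> points" using path_points path_step by blast
  then obtain l' u' where "is_cube l' u'" "r \<in> box l' u'" by (rule pointsE)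
  then have r: "clamp a b r \<in> points" using cube_clamp[OF _ ab] box_points by blast
  note c = cube_clamp[OF path_step.hyps(1) ab]
  have "cdist (clamp a b p) (clamp a b q) \<le> edist p q"
    using cdist_cube[OF c(1) c(2) c(2)] c(3) path_step by simp
  then show ?case
    using P.triangle[of "clamp a b p" "clamp a b q" "clamp a b r"] path_step c r box_points by fastforce
qed

lemma compact_box: "compact (box l u)"
proof -
  have "box l u = PiE UNIV (\<lambda>i. {of_int (l i)..of_int (u i)})"
    by (auto simp: box_def PiE_def Pi_def)
  moreover have "compactin (product_topology (\<lambda>_. euclidean) UNIV) (PiE UNIV (\<lambda>i. {real_of_int (l i)..of_int (u i)}))"
    unfolding compactin_PiE by auto
  ultimately show ?thesis by (simp add: euclidean_product_topology)
qed

text \<open>Links the product topology, in which boxes are compact, to the metric: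
  \<open>cdist x\<close> is 1-Lipschitz, and on a single cube distances are Euclidean, hence
  continuous in the finitely many coordinates.\<close>

lemma continuous_cdist:
  assumes "is_cube l u" "x \<in> points"
  shows "continuous_on (box l u) (cdist x)"
proof -
  have "(cdist x \<longlongrightarrow> cdist x c) (at c within box l u)" if c: "c \<in> box l u" for c
  proof -
    have "((\<lambda>y. y i) \<longlongrightarrow> c i) (at c within box l u)" for i
      using continuous_on_product_coordinates[of i]
      by (metis UNIV_I continuous_on_def subset_UNIV tendsto_within_subset)
    then have "((\<lambda>y. edist y c) \<longlongrightarrow> sqrt (\<Sum>i\<in>I. (c i - c i)\<^sup>2)) (at c within box l u)"
      unfolding edist_def L2_set_def by (intro tendsto_intros)
    then have "((\<lambda>y. edist y c) \<longlongrightarrow> 0) (at c within box l u)" by simp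
    moreover have "eventually (\<lambda>y. norm (cdist x y - cdist x c) \<le> edist y c) (at c within box l u)"
      unfolding eventually_at_filter
    proof (rule always_eventually, intro allI impI)
      fix y assume y: "y \<in> box l u"
      have "cdist x y \<le> cdist x c + cdist c y" "cdist x c \<le> cdist x y + cdist y c"
        using P.triangle assms box_points c y by blast+
      then show "norm (cdist x y - cdist x c) \<le> edist y c"
        using cdist_cube[OF assms(1) y c] by (auto simp: P.commute[of c y])
    qed
    ultimately have "((\<lambda>y. cdist x y - cdist x c) \<longlongrightarrow> 0) (at c within box l u)"
      by (rule Lim_null_comparison[rotated])
    then show ?thesis by (simp add: LIM_zero_iff)
  qed
  then show ?thesis by (simp add: continuous_on_def)
qed

text \<open>Gluing needs a distance to split exactly. \<open>pts a b\<close> is a finite union of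
  compact boxes, so a shortest detour through it exists.\<close>

lemma attains_inf:
  assumes xy: "x \<in> points" "y \<in> points" and ne: "pts a b \<noteq> {}"
  obtains c where "c \<in> pts a b" "\<And>c'. c' \<in> pts a b \<Longrightarrow> cdist x c + cdist c y \<le> cdist x c' + cdist c' y"
proof -
  define Q where "Q = {(l, u). is_cube l u \<and> a \<le> l \<and> u \<le> b}"
  define f where "f = (\<lambda>c. cdist x c + cdist y c)"
  have "Q \<subseteq> V \<times> V" using is_cubeD by (auto simp: Q_def)
  then have "finite Q" using fin_V by (meson finite_SigmaI finite_subset)
  have un: "pts a b = (\<Union>(l,u)\<in>Q. box l u)" by (auto simp: pts_def Q_def)
  have "\<exists>c\<in>box l u. \<forall>c'\<in>box l u. f c \<le> f c'" if "(l, u) \<in> Q" for l u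
  proof (rule continuous_attains_inf[OF compact_box])
    have "is_cube l u" using that by (simp add: Q_def)
    then have "of_int \<circ> l \<in> box l u" using is_cubeD(3) by (auto simp: box_def le_fun_def)
    then show "box l u \<noteq> {}" by blast
    show "continuous_on (box l u) f"
      unfolding f_def using that xy by (intro continuous_intros continuous_cdist) (auto simp: Q_def)
  qed
  then have "\<forall>q\<in>Q. \<exists>c. c \<in> case_prod box q \<and> (\<forall>c'\<in>case_prod box q. f c \<le> f c')" by (clarsimp, blast)
  then obtain m where "\<forall>q\<in>Q. m q \<in> case_prod box q \<and> (\<forall>c'\<in>case_prod box q. f (m q) \<le> f c')"
    by (rule bchoice[THEN exE])
  then have m: "\<And>q. q \<in> Q \<Longrightarrow> m q \<in> case_prod box q"
    "\<And>q c'. q \<in> Q \<Longrightarrow> c' \<in> case_prod box q \<Longrightarrow> f (m q) \<le> f c'"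
    by auto
  have "Q \<noteq> {}" using ne un by auto
  define F where "F = (\<lambda>q. f (m q)) ` Q"
  have F: "finite F" "F \<noteq> {}" using \<open>finite Q\<close> \<open>Q \<noteq> {}\<close> by (auto simp: F_def)
  obtain q where q: "q \<in> Q" "Min F = f (m q)" using Min_in[OF F] by (auto simp: F_def)
  have qmin: "f (m q) \<le> f (m q')" if "q' \<in> Q" for q'
    using Min_le[OF F(1), of "f (m q')"] that q(2) by (auto simp: F_def)
  show ?thesis
  proof
    show "m q \<in> pts a b" using m(1)[OF q(1)] q(1) un by auto
    fix c' assume "c' \<in> pts a b"
    then obtain q' where "q' \<in> Q" "c' \<in> case_prod box q'" using un by auto
    then have "f (m q) \<le> f c'" using m(2) qmin order_trans by blast
    then show "cdist x (m q) + cdist (m q) y \<le> cdist x c' + cdist c' y"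
      by (simp add: f_def P.commute[of y])
  qed
qed

section \<open>Cuts and the induction over intervals\<close>

lemma edist_sq: "(edist x y)\<^sup>2 = (\<Sum>i\<in>I. (x i - y i)\<^sup>2)"
  by (simp add: edist_def L2_set_def sum_nonneg)

lemma CN_box:
  assumes "is_cube a b"
  shows "P.CN (box a b)"
  unfolding P.CN_def
proof (intro ballI)
  fix y z and l :: real assume yz: "y \<in> box a b" "z \<in> box a b" and l: "l \<in> {0..1}"
  define m where "m = (\<lambda>i. (1 - l) * y i + l * z i)"
  have m: "m \<in> box a b"
  proof -
    have "of_int (a i) \<le> m i \<and> m i \<le> of_int (b i)" for i
    proof -
      have "y i \<in> {of_int (a i)..of_int (b i)}" "z i \<in> {of_int (a i)..of_int (b i)}"
        using yz by (auto simp: box_def)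
      then have "(1 - l) *\<^sub>R y i + l *\<^sub>R z i \<in> {of_int (a i)..of_int (b i)}"
        using l by (intro convexD[OF convex_closed_interval]) auto
      then show ?thesis by (simp add: m_def)
    qed
    then show ?thesis by (simp add: box_def)
  qed
  have "P.cn x y z l m" if x: "x \<in> box a b" for x
  proof -
    have "(edist x m)\<^sup>2 = (1 - l) * (edist x y)\<^sup>2 + l * (edist x z)\<^sup>2 - l * (1 - l) * (edist y z)\<^sup>2"
      unfolding edist_sq sum_distrib_left sum.distrib[symmetric] sum_subtractf[symmetric]
      by (intro sum.cong refl) (simp add: m_def, algebra)
    then show ?thesis unfolding P.cn_def using cdist_cube[OF assms] x yz m by simp
  qed
  then show "\<exists>m\<in>box a b. \<forall>x\<in>box a b. P.cn x y z l m" using m by blast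
qed

lemma box_Int: "box l u \<inter> box l' u' = box (sup l l') (inf u u')"
  by (auto simp: box_def sup_int_def inf_int_def of_int_max of_int_min)

lemma is_cube_Int:
  assumes cube: "is_cube l u" "is_cube l' u'" and ne: "box l u \<inter> box l' u' \<noteq> {}"
  shows "is_cube (sup l l') (inf u u')"
proof -
  obtain x where "x \<in> box (sup l l') (inf u u')" using ne box_Int by blast
  then have "real_of_int (sup l l' i) \<le> of_int (inf u u' i)" for i
    unfolding box_def by (blast intro: order_trans)
  then have "sup l l' \<le> inf u u'" unfolding le_fun_def of_int_le_iff by blast
  moreover have "inf u u' i \<le> sup l l' i + 1" for i
    using is_cubeD(4)[OF cube(1), of i] by (simp add: sup_int_def inf_int_def)
  moreover have "{sup l l'..inf u u'} \<subseteq> V" using is_cubeD(5)[OF cube(1)] by auto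
  ultimately show ?thesis by (simp add: is_cube_def)
qed

text \<open>Two cubes through a common point meet in a cube, whose lowest corner is the supremum of
  theirs and whose highest corner is the infimum. It inherits the bound \<open>a'\<close> from one
  and \<open>b'\<close> from the other.\<close>

lemma pts_Int:
  assumes "a \<le> a'" "b' \<le> b"
  shows "pts a b' \<inter> pts a' b = pts a' b'"
proof
  show "pts a' b' \<subseteq> pts a b' \<inter> pts a' b"
    using assms by (force elim!: ptsE intro: box_pts)
  show "pts a b' \<inter> pts a' b \<subseteq> pts a' b'"
  proof
    fix x assume "x \<in> pts a b' \<inter> pts a' b"
    then obtain l u l' u' where 1: "is_cube l u" "a \<le> l" "u \<le> b'" "x \<in> box l u"
      and 2: "is_cube l' u'" "a' \<le> l'" "u' \<le> b" "x \<in> box l' u'" by (meson IntE ptsE)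
    have "x \<in> box l u \<inter> box l' u'" using 1 2 by blast
    then have "is_cube (sup l l') (inf u u')" "x \<in> box (sup l l') (inf u u')"
      using is_cube_Int[OF 1(1) 2(1)] box_Int by blast+
    then show "x \<in> pts a' b'" using 1 2 by (intro box_pts) (auto intro: le_supI2 le_infI1)
  qed
qed

text \<open>
  Any path from \<open>pts a b'\<close> to \<open>pts a' b\<close> has a breakpoint in both, since each cube lies in one of them.
  Clamping to the interval from \<open>a\<close> to \<open>b\<close> does not lengthen paths, so one may stay in \<open>pts a b\<close>.
\<close>

lemma CN_cut:
  assumes V: "a \<in> V" "b \<in> V" "a \<le> b" and le: "a \<le> a'" "b' \<le> b"
    and cover: "\<And>l u. is_cube l u \<Longrightarrow> a \<le> l \<Longrightarrow> u \<le> b \<Longrightarrow> u \<le> b' \<or> a' \<le> l"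
    and CN: "P.CN (pts a b')" "P.CN (pts a' b)" "P.CN (pts a' b')"
  shows "P.CN (pts a b)"
proof -
  have Int: "pts a b' \<inter> pts a' b = pts a' b'" using pts_Int[OF le] .
  have Un: "pts a b' \<union> pts a' b = pts a b"
  proof
    show "pts a b' \<union> pts a' b \<subseteq> pts a b" using le by (force elim!: ptsE intro: box_pts)
    show "pts a b \<subseteq> pts a b' \<union> pts a' b"
      using cover by (blast elim!: ptsE intro: box_pts)
  qed
  \<comment> \<open>Clamped breakpoints are used since the path may leave the interval. At the first
    clamped cube above \<open>a'\<close>, the breakpoint where it is entered lies in both
    parts.\<close>
  have crossing: "\<exists>c\<in>pts a' b'. cdist (clamp a b p) c + cdist c (clamp a b q) \<le> k"
    if "path p q k" "clamp a b p \<in> pts a b'" "clamp a b q \<in> pts a' b" for p q k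
    using that
  proof (induction rule: path.induct)
    case (path_refl p)
    then have "clamp a b p \<in> pts a' b'" using Int by blast
    moreover from this have "clamp a b p \<in> points" using pts_subset by blast
    ultimately show ?case by (intro bexI[of _ "clamp a b p"]) auto
  next
    case (path_step l u p q r k)
    define l' u' where "l' = sup a (inf b l)" "u' = sup a (inf b u)"
    note c = cube_clamp[OF path_step.hyps(1) V, folded l'_u'_def]
    have pq: "clamp a b p \<in> box l' u'" "clamp a b q \<in> box l' u'" using path_step c by auto
    have "a \<le> l'" "u' \<le> b" using V by (auto simp: l'_u'_def)
    then consider "u' \<le> b'" "a \<le> l'" | "a' \<le> l'" "u' \<le> b" using cover c(1) by blast
    then show ?case
    proof cases
      case 1
      then have "clamp a b q \<in> pts a b'" using pq c(1) box_pts by blast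
      then obtain w where w: "w \<in> pts a' b'" "cdist (clamp a b q) w + cdist w (clamp a b r) \<le> k"
        using path_step by blast
      have "cdist (clamp a b p) (clamp a b q) \<le> edist p q"
        using cdist_cube[OF c(1) pq] c(3) path_step by simp
      moreover have "cdist (clamp a b p) w \<le> cdist (clamp a b p) (clamp a b q) + cdist (clamp a b q) w"
        using P.triangle pq box_points[OF c(1)] w(1) pts_subset by blast
      ultimately show ?thesis using w by (intro bexI[of _ w]) auto
    next
      case 2
      then have "clamp a b p \<in> pts a' b'" using pq c(1) box_pts Int path_step by blast
      moreover have "cdist (clamp a b p) (clamp a b r) \<le> edist p q + k"
        using path.path_step[of l u p q r k] path_step by (intro cdist_clamp_path V) auto
      moreover from calculation have "clamp a b p \<in> points" using pts_subset by blast
      ultimately show ?thesis by (intro bexI[of _ "clamp a b p"]) auto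
    qed
  qed
  have sep: "\<exists>c\<in>pts a b' \<inter> pts a' b. cdist x y = cdist x c + cdist c y"
    if x: "x \<in> pts a b'" and y: "y \<in> pts a' b" for x y
  proof -
    have xy: "x \<in> points" "y \<in> points" using x y pts_subset by auto
    have "clamp a b x = x" "clamp a b y = y" using x y Un clamp_pts[OF V] by blast+
    then have cr: "\<exists>c\<in>pts a' b'. cdist x c + cdist c y \<le> k" if "path x y k" for k
      using crossing[OF that] x y by simp
    then have "pts a' b' \<noteq> {}" using path_exists[OF xy] by blast
    then obtain c where c: "c \<in> pts a' b'"
      "\<And>c'. c' \<in> pts a' b' \<Longrightarrow> cdist x c + cdist c y \<le> cdist x c' + cdist c' y"
      using attains_inf[OF xy] by blast
    have "cdist x c + cdist c y \<le> cdist x y"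
      using cr c(2) by (intro le_cdist xy) (meson order_trans)
    moreover have "cdist x y \<le> cdist x c + cdist c y"
      using P.triangle xy c(1) pts_subset by blast
    ultimately show ?thesis using c(1) Int by force
  qed
  show ?thesis
    using P.CN_Un[OF pts_subset pts_subset CN(1,2) _ sep] CN(3) unfolding Int Un by blast
qed

text \<open>A maximal element exists by finiteness, and its supremum with any other element cannot
  exceed it.\<close>

lemma max_of_sup_closed:
  assumes "W \<subseteq> V" "W \<noteq> {}" "\<And>v w. v \<in> W \<Longrightarrow> w \<in> W \<Longrightarrow> sup v w \<in> W"
  obtains w where "w \<in> W" "\<And>v. v \<in> W \<Longrightarrow> v \<le> w"
proof -
  have "finite W" using assms(1) fin_V finite_subset by blast
  then obtain w where w: "w \<in> W" "\<And>v. v \<in> W \<Longrightarrow> w \<le> v \<Longrightarrow> w = v"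
    using finite_has_maximal assms(2) by metis
  then have "v \<le> w" if "v \<in> W" for v
    using assms(3)[OF w(1) that] by (metis sup.cobounded1 sup.cobounded2)
  then show ?thesis using that w by blast
qed

lemma min_of_inf_closed:
  assumes "W \<subseteq> V" "W \<noteq> {}" "\<And>v w. v \<in> W \<Longrightarrow> w \<in> W \<Longrightarrow> inf v w \<in> W"
  obtains w where "w \<in> W" "\<And>v. v \<in> W \<Longrightarrow> w \<le> v"
proof -
  have "finite W" using assms(1) fin_V finite_subset by blast
  then obtain w where w: "w \<in> W" "\<And>v. v \<in> W \<Longrightarrow> v \<le> w \<Longrightarrow> w = v"
    using finite_has_minimal assms(2) by metis
  then have "w \<le> v" if "v \<in> W" for v
    using assms(3)[OF w(1) that] by (metis inf.cobounded1 inf.cobounded2)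
  then show ?thesis using that w by blast
qed

text \<open>Cuts are found as coordinate half-spaces. The vertices with \<open>v i \<le> s\<close>
  are closed under \<open>sup\<close> and those with \<open>v j \<ge> a j + 1\<close> under
  \<open>inf\<close>, so their extreme elements \<open>b'\<close> and \<open>a'\<close> turn the
  half-spaces into proper subintervals.\<close>

lemma CN_cut_coordinates:
  assumes V: "a \<in> V" "b \<in> V" "a \<le> b"
    and s: "a i \<le> s" "s < b i" and j: "a j < b j"
    and cover: "\<And>l u. is_cube l u \<Longrightarrow> a \<le> l \<Longrightarrow> u \<le> b \<Longrightarrow> u i \<le> s \<or> a j + 1 \<le> l j"
    and IH: "\<And>a' b'. a' \<in> V \<Longrightarrow> b' \<in> V \<Longrightarrow> a \<le> a' \<Longrightarrow> b' \<le> b \<Longrightarrow> a' \<noteq> a \<or> b' \<noteq> b \<Longrightarrow> P.CN (pts a' b')"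
  shows "P.CN (pts a b)"
proof -
  obtain b' where b': "b' \<in> {v \<in> V. a \<le> v \<and> v \<le> b \<and> v i \<le> s}"
    "\<And>v. v \<in> {v \<in> V. a \<le> v \<and> v \<le> b \<and> v i \<le> s} \<Longrightarrow> v \<le> b'"
  proof (rule max_of_sup_closed[of "{v \<in> V. a \<le> v \<and> v \<le> b \<and> v i \<le> s}"])
    show "{v \<in> V. a \<le> v \<and> v \<le> b \<and> v i \<le> s} \<noteq> {}" using V s by blast
  qed (auto simp: sup_V intro: le_supI1)
  obtain a' where a': "a' \<in> {v \<in> V. a \<le> v \<and> v \<le> b \<and> a j + 1 \<le> v j}"
    "\<And>v. v \<in> {v \<in> V. a \<le> v \<and> v \<le> b \<and> a j + 1 \<le> v j} \<Longrightarrow> a' \<le> v"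
  proof (rule min_of_inf_closed[of "{v \<in> V. a \<le> v \<and> v \<le> b \<and> a j + 1 \<le> v j}"])
    show "{v \<in> V. a \<le> v \<and> v \<le> b \<and> a j + 1 \<le> v j} \<noteq> {}" using V j by force
  qed (auto simp: inf_V intro: le_infI1)
  have "a' \<noteq> a" "b' \<noteq> b" using a'(1) b'(1) s by auto
  moreover have "u \<le> b' \<or> a' \<le> l" if lu: "is_cube l u" "a \<le> l" "u \<le> b" for l u
  proof -
    have "u \<le> b'" if "u i \<le> s"
      using lu is_cubeD[OF lu(1)] that by (intro b'(2)) (auto intro: order_trans)
    moreover have "a' \<le> l" if "a j + 1 \<le> l j"
      using lu is_cubeD[OF lu(1)] that by (intro a'(2)) (auto intro: order_trans)
    ultimately show ?thesis using cover[OF lu] by blast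
  qed
  ultimately show ?thesis using a'(1) b'(1) V by (intro CN_cut[of a b a' b'] IH) auto
qed

text \<open>
  Raising all coordinates of \<open>a\<close> that can be raised individually gives a cube with lowest corner \<open>a\<close>.
  If its highest corner \<open>t S\<close> is not \<open>b\<close>, some coordinate \<open>i\<close> can be raised at \<open>t S\<close>. If \<open>i\<close> cannot be
  raised at \<open>a\<close>, then some \<open>j \<in> S\<close> must be raised before it, and every cube has \<open>i\<close> constantly at its
  lowest value or \<open>j\<close> above its lowest value. If it can, the hyperplane at height \<open>a i + 1\<close> is a cut.
\<close>

lemma CN_pts: "a \<in> V \<Longrightarrow> b \<in> V \<Longrightarrow> P.CN (pts a b)"
proof (induction "card {v \<in> V. a \<le> v \<and> v \<le> b}" arbitrary: a b rule: less_induct)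
  case less
  note V = less.prems
  show ?case
  proof (cases "a \<le> b")
    case False
    then have "pts a b = {}" using is_cubeD(3) by (auto elim!: ptsE) (meson order_trans)
    then show ?thesis by (simp add: P.CN_def)
  next
    case ab: True
    have IH: "P.CN (pts a' b')"
      if "a' \<in> V" "b' \<in> V" "a \<le> a'" "b' \<le> b" "a' \<noteq> a \<or> b' \<noteq> b" for a' b'
    proof (rule less.hyps)
      have "{v \<in> V. a' \<le> v \<and> v \<le> b'} \<subset> {v \<in> V. a \<le> v \<and> v \<le> b}"
      proof
        show "{v \<in> V. a' \<le> v \<and> v \<le> b'} \<subseteq> {v \<in> V. a \<le> v \<and> v \<le> b}"
          using that by (auto intro: order_trans)
        have "a \<notin> {v \<in> V. a' \<le> v \<and> v \<le> b'} \<or> b \<notin> {v \<in> V. a' \<le> v \<and> v \<le> b'}"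
          using that by (auto simp: order_antisym)
        then show "{v \<in> V. a' \<le> v \<and> v \<le> b'} \<noteq> {v \<in> V. a \<le> v \<and> v \<le> b}" using V ab by blast
      qed
      then show "card {v \<in> V. a' \<le> v \<and> v \<le> b'} < card {v \<in> V. a \<le> v \<and> v \<le> b}"
        using fin_V by (intro psubset_card_mono) auto
    qed (use that in auto)
    define S where "S = {i. a i < b i \<and> a(i := a i + 1) \<in> V}"
    define t where "t = (\<lambda>T i. if i \<in> T then a i + 1 else a i)"
    have "S \<subseteq> I"
    proof
      fix i assume "i \<in> S"
      then have "(a(i := a i + 1)) i \<noteq> 0 \<or> a i \<noteq> 0" "a(i := a i + 1) \<in> V" by (auto simp: S_def)
      then show "i \<in> I" using off V(1) by blast
    qed
    then have "finite S" using fin_I finite_subset by blast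
    have tV: "t T \<in> V" if "T \<subseteq> S" for T
    proof -
      have "finite T" using that \<open>finite S\<close> finite_subset by blast
      then show ?thesis using that
      proof (induction T)
        case empty
        then show ?case using V by (simp add: t_def)
      next
        case (insert i T)
        have "t (insert i T) = sup (t T) (a(i := a i + 1))"
          by (auto simp: t_def fun_eq_iff sup_int_def)
        moreover have "t T \<in> V" "a(i := a i + 1) \<in> V" using insert by (auto simp: S_def)
        ultimately show ?case using sup_V by metis
      qed
    qed
    have cube: "is_cube a (t S)"
      unfolding is_cube_def
    proof (intro conjI allI subsetI)
      fix v assume "v \<in> {a..t S}"
      then have v: "a i \<le> v i" "v i \<le> t S i" for i by (auto simp: le_fun_def)
      define T where "T = {i. v i \<noteq> a i}"
      have "T \<subseteq> S"
      proof
        fix i assume "i \<in> T"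
        then show "i \<in> S" using v[of i] by (auto simp: T_def t_def split: if_splits)
      qed
      moreover have "v = t T"
      proof
        fix i show "v i = t T i" using v[of i] by (auto simp: T_def t_def split: if_splits)
      qed
      ultimately show "v \<in> V" using tV by simp
    qed (auto simp: t_def le_fun_def)
    have "t S \<le> b" using ab by (auto simp: t_def le_fun_def S_def)
    show ?thesis
    proof (cases "b = t S")
      case True
      have "pts a b = box a b"
      proof
        show "pts a b \<subseteq> box a b"
        proof
          fix x assume "x \<in> pts a b"
          then have "clamp a b x = x" using clamp_pts[OF V ab] by blast
          then have "x i = clamp a b x i" for i by simp
          moreover have "of_int (a i) \<le> clamp a b x i" "clamp a b x i \<le> of_int (b i)" for i
            using ab by (auto simp: clamp_def le_fun_def)
          ultimately show "x \<in> box a b" by (simp add: box_def)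
        qed
        show "box a b \<subseteq> pts a b" using cube True box_pts by blast
      qed
      then show ?thesis using CN_box cube True by simp
    next
      case False
      then obtain i where i: "t S i < b i" "(t S)(i := t S i + 1) \<in> V"
        using accessible[of "t S" b] \<open>t S \<le> b\<close> tV V by blast
      show ?thesis
      proof (cases "i \<in> S")
        case True
        then have s: "a i + 1 < b i" using i by (simp add: t_def)
        have "u i \<le> a i + 1 \<or> a i + 1 \<le> l i" if "is_cube l u" for l u
          using is_cubeD(4)[OF that, of i] by linarith
        then show ?thesis using s by (intro CN_cut_coordinates[OF V ab, of i "a i + 1" i] IH) auto
      next
        case False
        then have i': "a i < b i" "a(i := a i + 1) \<notin> V" using i by (auto simp: t_def S_def)
        let ?W = "{v \<in> V. a \<le> v \<and> a i + 1 \<le> v i}"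
        have tW: "(t S)(i := t S i + 1) \<in> ?W" using i False by (auto simp: t_def le_fun_def)
        \<comment> \<open>\<open>w\<close> is the least vertex above \<open>a\<close> at which
          \<open>i\<close> has been raised; the entries where it exceeds \<open>a\<close> are those
          that have to be raised with \<open>i\<close>.\<close>
        obtain w where w: "w \<in> ?W" "\<And>v. v \<in> ?W \<Longrightarrow> w \<le> v"
        proof (rule min_of_inf_closed[of ?W])
          show "?W \<noteq> {}" using tW by blast
        qed (auto simp: inf_V inf_int_def)
        have wa: "a k \<le> w k" "w k \<le> ((t S)(i := t S i + 1)) k" for k
          using w(1) w(2)[OF tW] by (auto simp: le_fun_def)
        have "\<exists>j\<in>S. w j \<ge> a j + 1"
        proof (rule ccontr)
          assume "\<not> (\<exists>j\<in>S. w j \<ge> a j + 1)"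
          then have "w k = a k" if "k \<in> S" for k
            using wa(1)[of k] that by force
          then have "w k = (a(i := a i + 1)) k" for k
            using wa[of k] w(1) False by (cases "k = i"; cases "k \<in> S") (auto simp: t_def)
          then have "w = a(i := a i + 1)" by blast
          then show False using w(1) i'(2) by simp
        qed
        then obtain j where j: "j \<in> S" "w j \<ge> a j + 1" by blast
        have jmin: "v j \<ge> a j + 1" if "v \<in> V" "a \<le> v" "v i \<ge> a i + 1" for v
          using j(2) w(2)[of v] that by (auto simp: le_fun_def intro: order_trans)
        have "u i \<le> a i \<or> a j + 1 \<le> l j" if lu: "is_cube l u" "a \<le> l" for l u
        proof (rule ccontr)
          assume *: "\<not> (u i \<le> a i \<or> a j + 1 \<le> l j)"
          note c = is_cubeD[OF lu(1)]
          have le: "l k \<le> u k" "a k \<le> l k" for k using c(3) lu(2) by (auto simp: le_fun_def)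
          \<comment> \<open>The vertex of the cube that differs from \<open>l\<close> at most in
            entry \<open>i\<close>: there \<open>i\<close> is raised while \<open>j\<close> is still
            at its lowest value.\<close>
          have "l(i := u i) \<in> V" by (intro c(5)) (auto simp: le_fun_def le)
          moreover have "a \<le> l(i := u i)" using le by (auto simp: le_fun_def) (meson order_trans)
          moreover have "(l(i := u i)) i \<ge> a i + 1" using * by simp
          ultimately have "(l(i := u i)) j \<ge> a j + 1" by (rule jmin)
          moreover have "i \<noteq> j" using j(1) False by blast
          ultimately show False using * by simp
        qed
        then show ?thesis using i' j(1)
          by (intro CN_cut_coordinates[OF V ab, of i "a i" j] IH) (auto simp: S_def)
      qed
    qed
  qed
qed

theorem CN_points: "P.CN points"
proof (cases "V = {}")
  case True
  then have "points = {}" using is_cubeD(1) pointsE by (metis empty_iff equals0I)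
  then show ?thesis by (simp add: P.CN_def)
next
  case False
  obtain a where a: "a \<in> V" "\<And>v. v \<in> V \<Longrightarrow> a \<le> v"
    using min_of_inf_closed[of V] False inf_V by blast
  obtain b where b: "b \<in> V" "\<And>v. v \<in> V \<Longrightarrow> v \<le> b"
    using max_of_sup_closed[of V] False sup_V by blast
  have "points = pts a b"
    using a(2) b(2) is_cubeD(1,2) unfolding points_def pts_def by blast
  then show ?thesis using CN_pts a(1) b(1) by simp
qed

end

section \<open>Positions of the arm as integer vectors\<close>

definition vertical :: "heading \<Rightarrow> int" where
  "vertical h = (if h = East then 0 else 1)"

text \<open>The value 0 beyond the end of the arm is what the lattice demands outside its index
  set.\<close>

definition height :: "heading list \<Rightarrow> nat \<Rightarrow> int" where
  "height u k = (if k \<le> length u then \<Sum>j<k. vertical (u ! j) else 0)"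

text \<open>
  The first two conditions say that \<open>h\<close> counts elements of a set \<open>A\<close> of links, the third one that
  \<open>A\<close> contains no two consecutive links. Links are numbered from 0, so \<open>h k\<close> counts links below \<open>k\<close>.
\<close>

definition heights :: "nat \<Rightarrow> (nat \<Rightarrow> int) set" where
  "heights n = {h. h 0 = 0 \<and> (\<forall>k<n. h k \<le> h (Suc k) \<and> h (Suc k) \<le> h k + 1) \<and>
     (\<forall>k. Suc k < n \<longrightarrow> h (Suc (Suc k)) \<le> h k + 1) \<and> (\<forall>k>n. h k = 0)}"

text \<open>The strip has width 1, so vertical links alternate: the parity of the number of earlier
  vertical links decides between \<open>North\<close> and \<open>South\<close>.\<close>

definition state :: "nat \<Rightarrow> (nat \<Rightarrow> int) \<Rightarrow> heading list" where
  "state n h = map (\<lambda>k. if h (Suc k) = h k then East else if even (h k) then North else South) [0..<n]"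

section \<open>Positions and height vectors correspond\<close>

lemma heightsD:
  assumes "h \<in> heights n"
  shows "h 0 = 0" "\<And>k. k < n \<Longrightarrow> h k \<le> h (Suc k)" "\<And>k. k < n \<Longrightarrow> h (Suc k) \<le> h k + 1"
    "\<And>k. Suc k < n \<Longrightarrow> h (Suc (Suc k)) \<le> h k + 1" "\<And>k. n < k \<Longrightarrow> h k = 0"
  using assms unfolding heights_def by auto

lemma heights_mono:
  assumes "h \<in> heights n" "j \<le> k" "k \<le> n"
  shows "h j \<le> h k"
  using assms(2,3)
proof (induction k rule: dec_induct)
  case (step k)
  then show ?case using heightsD(2)[OF assms(1), of k] by simp
qed simp

lemma length_state [simp]: "length (state n h) = n"
  by (simp add: state_def)

lemma nth_state: "k < n \<Longrightarrow>
    state n h ! k = (if h (Suc k) = h k then East else if even (h k) then North else South)"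
  by (simp add: state_def)

lemma height_Suc: "k < length u \<Longrightarrow> height u (Suc k) = height u k + vertical (u ! k)"
  by (simp add: height_def)

lemma height_0 [simp]: "height u 0 = 0"
  by (simp add: height_def)

lemma height_state:
  assumes "h \<in> heights n"
  shows "height (state n h) = h"
proof
  note H = heightsD[OF assms]
  have "k \<le> n \<Longrightarrow> height (state n h) k = h k" for k
  proof (induction k)
    case (Suc k)
    then have "height (state n h) (Suc k) = h k + vertical (state n h ! k)"
      by (simp add: height_Suc)
    then show ?case using H(2,3)[of k] Suc.prems by (auto simp: nth_state vertical_def)
  qed (use H in simp)
  moreover have "n < k \<Longrightarrow> height (state n h) k = h k" for k using H(5) by (simp add: height_def)
  ultimately show "height (state n h) k = h k" for k using not_le by blast
qed

lemma joint_Suc: "joint u (Suc k) = joint u k + link_vector (u ! k)"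
  by (simp add: joint_def)

lemma joint_0 [simp]: "joint u 0 = (0, 0)"
  by (simp add: joint_def zero_prod_def)

lemma joint_state:
  assumes "h \<in> heights n" "k \<le> n"
  shows "joint (state n h) k = (int k - h k, h k mod 2)"
  using assms(2)
proof (induction k)
  case 0
  then show ?case using heightsD(1)[OF assms(1)] by simp
next
  case (Suc k)
  note H = heightsD[OF assms(1)]
  have "joint (state n h) (Suc k) = (int k - h k, h k mod 2) + link_vector (state n h ! k)"
    using Suc by (simp add: joint_Suc)
  moreover have "h (Suc k) = h k \<or> h (Suc k) = h k + 1" using H(2,3)[of k] Suc.prems by auto
  ultimately show ?case using Suc.prems
    by (auto simp: nth_state) presburger+
qed

text \<open>Of two consecutive links at least one is horizontal, so the first coordinate of the
  joints increases over two steps. Adjacent joints with equal first coordinate differ in the parity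
  of the height.\<close>

lemma state_position:
  assumes h: "h \<in> heights n"
  shows "state n h \<in> positions n"
proof -
  note H = heightsD[OF h]
  have le: "h k \<le> int k" if "k \<le> n" for k
    using that
  proof (induction k)
    case (Suc k)
    then show ?case using H(3)[of k] by simp
  qed (simp add: H(1))
  have ge: "0 \<le> h k" if "k \<le> n" for k using heights_mono[OF h, of 0 k] H(1) that by simp
  have "joint (state n h) ` {..n} \<subseteq> {0..int n} \<times> {0..1}"
  proof (rule image_subsetI)
    fix k assume "k \<in> {..n}"
    then have "k \<le> n" by simp
    moreover have "h k mod 2 \<in> {0..1}" by simp
    ultimately show "joint (state n h) k \<in> {0..int n} \<times> {0..1}"
      using le[of k] ge[of k] by (simp add: joint_state[OF h])
  qed
  moreover have "inj_on (joint (state n h)) {..n}"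
  proof (rule linorder_inj_onI)
    fix j k assume jk: "j < k" "j \<in> {..n}" "k \<in> {..n}"
    show "joint (state n h) j \<noteq> joint (state n h) k"
    proof
      assume "joint (state n h) j = joint (state n h) k"
      then have eq: "int j - h j = int k - h k" "h j mod 2 = h k mod 2"
        using jk by (auto simp: joint_state[OF h])
      have mono: "int j - h j \<le> int k - h k" if "j \<le> k" "k \<le> n" for j k
        using that
      proof (induction k rule: dec_induct)
        case (step k)
        then show ?case using H(3)[of k] by simp
      qed simp
      show False
      proof (cases "k = Suc j")
        case True
        then show False using eq by presburger
      next
        case False
        then have "Suc (Suc j) \<le> k" using jk by simp
        then show False using mono[of "Suc (Suc j)" k] H(4)[of j] eq(1) jk by auto
      qed
    qed
  qed auto
  ultimately show ?thesis by (simp add: positions_def)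
qed

text \<open>The second coordinate of a joint has the parity of its height, and the strip leaves only
  one vertical heading there. Two consecutive vertical links would cancel and revisit a
  joint.\<close>

lemma positionD:
  assumes u: "u \<in> positions n" and k: "k < n"
  shows "u ! k \<noteq> East \<Longrightarrow> u ! k = (if even (height u k) then North else South)"
    and "Suc k < n \<Longrightarrow> u ! k = East \<or> u ! Suc k = East"
proof -
  have len: "length u = n" and inj: "inj_on (joint u) {..n}"
    and sub: "joint u ` {..n} \<subseteq> {0..int n} \<times> {0..1}"
    using u by (auto simp: positions_def)
  have y: "snd (joint u k) \<in> {0..1}" if "k \<le> n" for k
  proof -
    have "joint u k \<in> {0..int n} \<times> {0..1}" using sub that by blast
    then show ?thesis by (simp only: mem_Times_iff)
  qed
  have yk: "even (snd (joint u k)) \<longleftrightarrow> even (height u k)" if "k \<le> n" for k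
    using that
  proof (induction k)
    case (Suc k)
    then show ?case
      by (cases "u ! k") (auto simp: joint_Suc height_Suc len vertical_def)
  qed simp
  have head: "u ! k = (if even (height u k) then North else South)" if "u ! k \<noteq> East" "k < n" for k
    using that y[of k] y[of "Suc k"] yk[of k] by (cases "u ! k") (auto simp: joint_Suc)
  show "u ! k \<noteq> East \<Longrightarrow> u ! k = (if even (height u k) then North else South)" using head k by blast
  assume k': "Suc k < n"
  show "u ! k = East \<or> u ! Suc k = East"
  proof (rule ccontr)
    assume *: "\<not> (u ! k = East \<or> u ! Suc k = East)"
    then have "height u (Suc k) = height u k + 1" using k len by (simp add: height_Suc vertical_def)
    then have "joint u (Suc (Suc k)) = joint u k"
      using head[of k] head[of "Suc k"] * k k' by (auto simp: joint_Suc zero_prod_def add.assoc split: if_splits)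
    then show False using inj_onD[OF inj, of "Suc (Suc k)" k] k' by simp
  qed
qed

lemma height_position:
  assumes u: "u \<in> positions n"
  shows "height u \<in> heights n" and "state n (height u) = u"
proof -
  have len: "length u = n" using u by (simp add: positions_def)
  show "height u \<in> heights n"
    unfolding heights_def
    using positionD(2)[OF u] by (auto simp: height_Suc len vertical_def) (auto simp: height_def len)
  show "state n (height u) = u"
  proof (rule nth_equalityI)
    fix k assume "k < length (state n (height u))"
    then show "state n (height u) ! k = u ! k"
      using positionD(1)[OF u, of k] by (auto simp: nth_state height_Suc len vertical_def)
  qed (simp add: len)
qed

lemma finite_positions: "finite (positions n)"
proof (rule finite_subset)
  show "positions n \<subseteq> {u. set u \<subseteq> {North, South, East} \<and> length u = n}"
    using heading.exhaust by (auto simp: positions_def)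
qed (simp add: finite_lists_length_eq)

text \<open>
  Take the least \<open>i\<close> with \<open>a i < b i\<close> and raise the last entry \<open>m\<close> on the plateau of \<open>a\<close> containing \<open>i\<close>.
\<close>

lemma heights_accessible:
  assumes a: "a \<in> heights n" and b: "b \<in> heights n" and ab: "a \<le> b" "a \<noteq> b"
  shows "\<exists>i. a i < b i \<and> a(i := a i + 1) \<in> heights n"
proof -
  note A = heightsD[OF a] and B = heightsD[OF b]
  have le: "a k \<le> b k" for k using ab(1) by (simp add: le_fun_def)
  have "\<exists>k. a k < b k" using ab by (metis antisym_conv1 le ext)
  define i where "i = (LEAST k. a k < b k)"
  have i: "a i < b i" unfolding i_def using \<open>\<exists>k. a k < b k\<close> by (rule LeastI_ex)
  have below: "a k = b k" if "k < i" for k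
    using not_less_Least[of k "\<lambda>k. a k < b k"] that le[of k] by (simp add: i_def)
  have "i \<noteq> 0" using i A(1) B(1) by (metis less_irrefl)
  have "i \<le> n" using i A(5) B(5) by (metis less_irrefl not_le)
  define m where "m = Max {k. k \<le> n \<and> a k = a i}"
  have fin: "finite {k. k \<le> n \<and> a k = a i}" by simp
  have "m \<in> {k. k \<le> n \<and> a k = a i}"
    unfolding m_def using \<open>i \<le> n\<close> by (intro Max_in) auto
  then have m: "m \<le> n" "a m = a i" by auto
  have "i \<le> m" unfolding m_def using fin \<open>i \<le> n\<close> by (intro Max_ge) auto
  have up: "a m < a (Suc m)" if "m < n"
  proof -
    have "a (Suc m) \<noteq> a i" using Max_ge[OF fin, of "Suc m"] that by (auto simp: m_def[symmetric])
    then show ?thesis using A(2)[OF that] m by simp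
  qed
  \<comment> \<open>Raising entry \<open>m\<close> must respect its bounds by the two preceding
    entries. An entry before \<open>i\<close> agrees with \<open>b\<close>, which already rises
    above \<open>a\<close> at \<open>i\<close> under the same bounds.\<close>
  have down: "a m \<le> a k" if "k < m" "m \<le> k + 2" for k
  proof (cases "i \<le> k")
    case True
    then show ?thesis using heights_mono[OF a, of i k] m that by simp
  next
    case False
    then have "i = Suc k \<or> i = Suc (Suc k)" using \<open>i \<le> m\<close> that by auto
    then have "b i \<le> b k + 1" using B(3)[of k] B(4)[of k] \<open>i \<le> n\<close> by auto
    then show ?thesis using i m(2) below[of k] False by simp
  qed
  have "a m < b m" using i m heights_mono[OF b \<open>i \<le> m\<close> m(1)] by simp
  moreover have "a(m := a m + 1) \<in> heights n"
    unfolding heights_def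
  proof (intro CollectI conjI allI impI)
    show "(a(m := a m + 1)) 0 = 0" using A(1) \<open>i \<le> m\<close> \<open>i \<noteq> 0\<close> by simp
    show "(a(m := a m + 1)) k = 0" if "n < k" for k using A(5)[OF that] m(1) that by simp
    show "(a(m := a m + 1)) k \<le> (a(m := a m + 1)) (Suc k)" if "k < n" for k
      using A(2)[OF that] up that by auto
    show "(a(m := a m + 1)) (Suc k) \<le> (a(m := a m + 1)) k + 1" if "k < n" for k
      using A(3)[OF that] down[of k] by auto
    show "(a(m := a m + 1)) (Suc (Suc k)) \<le> (a(m := a m + 1)) k + 1" if "Suc k < n" for k
      using A(4)[OF that] down[of k] by auto
  qed
  ultimately show ?thesis by blast
qed

text \<open>Apart from the entries fixed to 0, heights are described by bounds on differences of two
  entries. Such bounds survive pointwise maxima and minima.\<close>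

lemma cubed_lattice_heights: "cubed_lattice (heights n) {1..n}"
proof
  show "finite (heights n)"
  proof (rule finite_subset)
    show "heights n \<subseteq> height ` positions n" using height_state state_position by (metis image_eqI subsetI)
  qed (simp add: finite_positions)
  show "v i = 0" if "v \<in> heights n" "i \<notin> {1..n}" for v i
    using heightsD(1,5)[OF that(1)] that(2) by (cases "i = 0") auto
  fix a b assume "a \<in> heights n" "b \<in> heights n"
  note ab = heightsD[OF this(1)] heightsD[OF this(2)]
  show "sup a b \<in> heights n"
    unfolding heights_def
  proof (intro CollectI conjI allI impI)
    show "sup a b k \<le> sup a b (Suc k)" "sup a b (Suc k) \<le> sup a b k + 1" if "k < n" for k
      using ab(2,3,7,8)[OF that] by (auto simp: sup_int_def max_def)
    show "sup a b (Suc (Suc k)) \<le> sup a b k + 1" if "Suc k < n" for k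
      using ab(4,9)[OF that] by (auto simp: sup_int_def max_def)
  qed (use ab in auto)
  show "inf a b \<in> heights n"
    unfolding heights_def
  proof (intro CollectI conjI allI impI)
    show "inf a b k \<le> inf a b (Suc k)" "inf a b (Suc k) \<le> inf a b k + 1" if "k < n" for k
      using ab(2,3,7,8)[OF that] by (auto simp: inf_int_def min_def)
    show "inf a b (Suc (Suc k)) \<le> inf a b k + 1" if "Suc k < n" for k
      using ab(4,9)[OF that] by (auto simp: inf_int_def min_def)
  qed (use ab in auto)
  show "\<exists>i. a i < b i \<and> a(i := a i + 1) \<in> heights n" if "a \<le> b" "a \<noteq> b"
    using \<open>a \<in> heights n\<close> \<open>b \<in> heights n\<close> that by (rule heights_accessible)
qed simp

section \<open>Moves as changes of a single height\<close>

fun valid :: "nat \<Rightarrow> move \<Rightarrow> bool" where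
  "valid n (Corner_Switch i) \<longleftrightarrow> Suc i < n"
| "valid n End_Flip \<longleftrightarrow> 0 < n"

text \<open>The only height that a move changes.\<close>

fun pos :: "nat \<Rightarrow> move \<Rightarrow> nat" where
  "pos n (Corner_Switch i) = Suc i"
| "pos n End_Flip = n"

lemma pos_inj: "valid n m \<Longrightarrow> valid n m' \<Longrightarrow> pos n m = pos n m' \<Longrightarrow> m = m'"
  by (cases m; cases m') auto

lemma pos_range: "valid n m \<Longrightarrow> pos n m \<in> {1..n}"
  by (cases m) auto

lemma pos_surj: "k \<in> {1..n} \<Longrightarrow> \<exists>m. valid n m \<and> pos n m = k"
proof (cases "k = n")
  case True
  then show "k \<in> {1..n} \<Longrightarrow> ?thesis" by (intro exI[of _ End_Flip]) auto
next
  case False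
  then show "k \<in> {1..n} \<Longrightarrow> ?thesis" by (intro exI[of _ "Corner_Switch (k - 1)"]) auto
qed

lemma finite_valid: "finite {m. valid n m}"
proof (rule finite_imageD)
  have "pos n ` {m. valid n m} \<subseteq> {1..n}" using pos_range by blast
  then show "finite (pos n ` {m. valid n m})" by (rule finite_subset) simp
  show "inj_on (pos n) {m. valid n m}" unfolding inj_on_def using pos_inj by blast
qed

text \<open>The distance 3 is what \<open>toggle_heights\<close> needs, since conditions on heights
  reach over two steps.\<close>

lemma commuting_iff:
  assumes "valid n m" "valid n m'"
  shows "commuting n m m' \<longleftrightarrow> pos n m + 3 \<le> pos n m' \<or> pos n m' + 3 \<le> pos n m"
proof -
  have CC: "{i, i + 1} \<inter> ({j - 1..j + 2} \<inter> {..<n}) = {} \<longleftrightarrow> i + 3 \<le> j \<or> j + 3 \<le> i"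
    if "Suc i < n" for i j
  proof -
    have "i \<in> {..<n}" "i + 1 \<in> {..<n}" using that by auto
    then have "{i, i + 1} \<inter> ({j - 1..j + 2} \<inter> {..<n}) = {} \<longleftrightarrow>
        \<not> (j \<le> i + 1 \<and> i \<le> j + 2) \<and> \<not> (j \<le> i + 2 \<and> i \<le> j + 1)"
      by auto
    then show ?thesis by linarith
  qed
  have EC: "{n - 1} \<inter> ({j - 1..j + 2} \<inter> {..<n}) = {} \<longleftrightarrow> j + 4 \<le> n" if "Suc j < n" for j
    using that by auto
  have CE: "{j, j + 1} \<inter> ({n - 2..n - 1} \<inter> {..<n}) = {} \<longleftrightarrow> j + 4 \<le> n" if "Suc j < n" for j
    using that by auto
  show ?thesis
  proof (cases m; cases m')
    fix i j assume m: "m = Corner_Switch i" "m' = Corner_Switch j"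
    then have v: "Suc i < n" "Suc j < n" using assms by simp_all
    show ?thesis
      unfolding m commuting_def changed.simps involved.simps pos.simps CC[OF v(1)] CC[OF v(2)] by linarith
  next
    fix i assume m: "m = Corner_Switch i" "m' = End_Flip"
    then have v: "Suc i < n" using assms by simp
    show ?thesis
      unfolding m commuting_def changed.simps involved.simps pos.simps CE[OF v] EC[OF v] using v by auto
  next
    fix i assume m: "m = End_Flip" "m' = Corner_Switch i"
    then have v: "Suc i < n" using assms by simp
    show ?thesis
      unfolding m commuting_def changed.simps involved.simps pos.simps CE[OF v] EC[OF v] using v by auto
  next
    assume m: "m = End_Flip" "m' = End_Flip"
    then show ?thesis using assms by (auto simp: commuting_def)
  qed
qed

text \<open>Both admissible values of entry \<open>k\<close> lie between \<open>h (k - 1)\<close>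
  and \<open>h (k - 1) + 1\<close>, and entry \<open>Suc k\<close> must be at least the larger one.
  So exactly one of the two links at joint \<open>k\<close> is vertical: the arm has a corner
  there.\<close>

lemma heights_update:
  assumes h: "h \<in> heights n" and g: "h(k := c) \<in> heights n" and c: "c \<noteq> h k" and k: "k \<in> {1..n}"
  shows "{h k, c} = {h (k - 1), h (k - 1) + 1}" "k < n \<Longrightarrow> h (Suc k) = h (k - 1) + 1"
proof -
  obtain j where j: "k = Suc j" using k by (cases k) auto
  have jn: "j < n" using k j by simp
  have 1: "h j \<le> h (Suc j)" "h (Suc j) \<le> h j + 1" using heightsD(2,3)[OF h jn] .
  have 2: "h j \<le> c" "c \<le> h j + 1" using heightsD(2,3)[OF g jn] by (simp_all add: j)
  show "{h k, c} = {h (k - 1), h (k - 1) + 1}" using 1 2 c by (auto simp: j)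
  assume "k < n"
  then have "h (Suc k) \<le> h j + 1" "h k \<le> h (Suc k)" "c \<le> h (Suc k)"
    using heightsD(2)[OF h, of k] heightsD(2)[OF g, of k] heightsD(4)[OF h, of j] by (auto simp: j)
  then show "h (Suc k) = h (k - 1) + 1" using 1 2 c by (auto simp: j)
qed

text \<open>A switched vertical link keeps its heading, because in both places it starts at height
  \<open>h i\<close>; links after the corner see unchanged heights.\<close>

lemma perform_state:
  assumes h: "h \<in> heights n" and m: "valid n m"
    and g: "h(pos n m := c) \<in> heights n" and c: "c \<noteq> h (pos n m)"
  shows "perform n m (state n h) = state n (h(pos n m := c))" and "applicable n m (state n h)"
proof -
  note U = heights_update[OF h g c pos_range[OF m]]
  show *: "perform n m (state n h) = state n (h(pos n m := c))"
  proof (rule nth_equalityI)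
    show "length (perform n m (state n h)) = length (state n (h(pos n m := c)))" by (cases m) auto
    fix k assume "k < length (perform n m (state n h))"
    then have k: "k < n" by (cases m) auto
    show "perform n m (state n h) ! k = state n (h(pos n m := c)) ! k"
    proof (cases m)
      case (Corner_Switch i)
      have "(h (Suc i) = h i \<and> c = h i + 1 \<or> h (Suc i) = h i + 1 \<and> c = h i) \<and> h (Suc (Suc i)) = h i + 1"
        using U m by (auto simp: Corner_Switch doubleton_eq_iff)
      then show ?thesis using k m
        by (auto simp: Corner_Switch nth_state nth_list_update)
    next
      case End_Flip
      then obtain j where n: "n = Suc j" using m by (cases n) auto
      have "h n = h j \<and> c = h j + 1 \<or> h n = h j + 1 \<and> c = h j"
        using U(1) by (auto simp: End_Flip n doubleton_eq_iff)
      moreover have "snd (joint (state n h) j) = h j mod 2" using joint_state[OF h, of j] n by simp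
      ultimately show ?thesis using k
        by (auto simp: End_Flip nth_state nth_list_update n)
    qed
  qed
  have pp: "perform n m (state n h) \<in> positions n" using state_position[OF g] * by simp
  show "applicable n m (state n h)"
  proof (cases m)
    case (Corner_Switch i)
    have "(h (Suc i) = h i \<or> h (Suc i) = h i + 1) \<and> h (Suc (Suc i)) = h i + 1"
      using U m by (auto simp: Corner_Switch doubleton_eq_iff)
    then have "state n h ! i \<noteq> state n h ! Suc i" using m by (auto simp: Corner_Switch nth_state)
    then show ?thesis using m pp by (simp add: Corner_Switch)
  next
    case End_Flip
    then show ?thesis using m pp by simp
  qed
qed

lemma applicable_update:
  assumes h: "h \<in> heights n" and app: "applicable n m (state n h)"
  shows "valid n m" and "\<exists>c. c \<noteq> h (pos n m) \<and> h(pos n m := c) \<in> heights n"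
proof -
  show v: "valid n m" using app by (cases m) auto
  define u w where "u = state n h" "w = perform n m (state n h)"
  note uw = this
  have w: "w \<in> positions n" using app by (cases m) (auto simp: uw)
  have len: "length u = n" "length w = n" using w by (auto simp: uw positions_def)
  have hu: "height u = h" using height_state[OF h] by (simp add: uw)
  have "w \<noteq> u"
  proof (cases m)
    case (Corner_Switch i)
    then have "w ! i \<noteq> u ! i" using app by (auto simp: uw)
    then show ?thesis by auto
  next
    case End_Flip
    then have "w ! (n - 1) \<noteq> u ! (n - 1)" using app by (simp add: uw)
    then show ?thesis by auto
  qed
  have off: "height w k = height u k" if "k \<noteq> pos n m" "k \<le> n" for k
  proof (cases m)
    case (Corner_Switch i)
    have "k \<le> n \<Longrightarrow> height w k = height u k + (if k = Suc i then vertical (u ! Suc i) - vertical (u ! i) else 0)" for k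
    proof (induction k)
      case (Suc k)
      then show ?case using v len
        by (auto simp: height_Suc Corner_Switch uw nth_list_update)
    qed simp
    then show ?thesis using that by (simp add: Corner_Switch)
  next
    case End_Flip
    have "k < n \<Longrightarrow> height w k = height u k" for k
    proof (induction k)
      case (Suc k)
      then show ?case using len by (auto simp: height_Suc End_Flip uw)
    qed simp
    then show ?thesis using that by (simp add: End_Flip)
  qed
  have "height w = h(pos n m := height w (pos n m))"
  proof
    fix k show "height w k = (h(pos n m := height w (pos n m))) k"
      using off[of k] hu len by (cases "k \<le> n") (auto simp: height_def)
  qed
  moreover have "height w \<noteq> h"
    using \<open>w \<noteq> u\<close> height_position(2)[OF w] by (auto simp: uw)
  ultimately have "height w (pos n m) \<noteq> h (pos n m)" by (metis fun_upd_triv)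
  then show "\<exists>c. c \<noteq> h (pos n m) \<and> h(pos n m := c) \<in> heights n"
    using height_position(1)[OF w] \<open>height w = _\<close> by metis
qed

text \<open>The base vertex of a cube need not be its lowest corner, so each direction carries a
  sign.\<close>

definition toggle :: "(nat \<Rightarrow> int) \<Rightarrow> (nat \<Rightarrow> int) \<Rightarrow> nat set \<Rightarrow> nat \<Rightarrow> int" where
  "toggle h e K k = (if k \<in> K then h k + e k else h k)"

text \<open>Each condition on heights involves entries at distance at most 2, hence at most one toggled entry.\<close>

lemma toggle_heights:
  assumes h: "h \<in> heights n" and K: "\<And>k. k \<in> K \<Longrightarrow> h(k := h k + e k) \<in> heights n"
    and apart: "\<And>j k. j \<in> K \<Longrightarrow> k \<in> K \<Longrightarrow> j < k \<Longrightarrow> j + 3 \<le> k"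
  shows "toggle h e K \<in> heights n"
proof -
  have window: "\<exists>g\<in>heights n. \<forall>i\<in>{k..k + 2}. toggle h e K i = g i" for k
  proof (cases "\<exists>j\<in>K. j \<in> {k..k + 2}")
    case True
    then obtain j where j: "j \<in> K" "j \<in> {k..k + 2}" by blast
    have "toggle h e K i = (h(j := h j + e j)) i" if "i \<in> {k..k + 2}" for i
    proof -
      have "i \<notin> K" if "i \<noteq> j"
        using apart[OF j(1), of i] apart[of i, OF _ j(1)] that j(2) \<open>i \<in> {k..k + 2}\<close>
        by (cases i j rule: linorder_cases) auto
      then show ?thesis using j by (auto simp: toggle_def)
    qed
    then show ?thesis using K[OF j(1)] by blast
  next
    case False
    then show ?thesis using h by (intro bexI[of _ h]) (auto simp: toggle_def)
  qed
  show ?thesis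
    unfolding heights_def
  proof (intro CollectI conjI allI impI)
    show "toggle h e K 0 = 0" using window[of 0] heightsD(1) by fastforce
    show "toggle h e K k = 0" if "n < k" for k using window[of k] heightsD(5) that by fastforce
  next
    fix k assume "k < n"
    obtain g where "g \<in> heights n" "\<forall>i\<in>{k..k + 2}. toggle h e K i = g i" using window by blast
    then show "toggle h e K k \<le> toggle h e K (Suc k)" "toggle h e K (Suc k) \<le> toggle h e K k + 1"
      using heightsD(2,3)[of g n k] \<open>k < n\<close> by auto
  next
    fix k assume "Suc k < n"
    obtain g where "g \<in> heights n" "\<forall>i\<in>{k..k + 2}. toggle h e K i = g i" using window by blast
    then show "toggle h e K (Suc (Suc k)) \<le> toggle h e K k + 1"
      using heightsD(4)[of g n k] \<open>Suc k < n\<close> by auto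
  qed
qed

section \<open>The state complex in coordinates\<close>

definition tent :: "real \<Rightarrow> real" where
  "tent y = max 0 (1 - \<bar>y\<bar>)"

text \<open>
  The multilinear weights of a point \<open>x\<close> of a cube of heights, written without mentioning the cube:
  a factor is \<open>t\<close>, \<open>1 - t\<close> or \<open>1\<close> at the corners of the cube, and some factor vanishes elsewhere.
\<close>

definition embed :: "nat \<Rightarrow> (nat \<Rightarrow> real) \<Rightarrow> heading list \<Rightarrow> real" where
  "embed n x v = (if v \<in> positions n then \<Prod>k=1..n. tent (x k - height v k) else 0)"

text \<open>The expected height of a random position distributed according to the weights \<open>p\<close>.\<close>

definition unembed :: "nat \<Rightarrow> (heading list \<Rightarrow> real) \<Rightarrow> nat \<Rightarrow> real" where
  "unembed n p k = (\<Sum>v\<in>positions n. p v * height v k)"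

text \<open>
  The direction \<open>m\<close> of the cube \<open>c\<close> changes the height at \<open>pos n m\<close> by the sign \<open>e (pos n m)\<close>,
  starting from the heights \<open>h\<close> of the base vertex.
\<close>

definition charted :: "nat \<Rightarrow> (move, heading list) cube \<Rightarrow> (nat \<Rightarrow> int) \<Rightarrow> (nat \<Rightarrow> int) \<Rightarrow> bool" where
  "charted n c h e \<longleftrightarrow> (\<forall>m\<in>dirs c. valid n m) \<and> (\<forall>k. \<bar>e k\<bar> = 1) \<and>
     (\<forall>T\<subseteq>dirs c. toggle h e (pos n ` T) \<in> heights n \<and> corner c T = state n (toggle h e (pos n ` T)))"

definition lower :: "(nat \<Rightarrow> int) \<Rightarrow> (nat \<Rightarrow> int) \<Rightarrow> nat set \<Rightarrow> nat \<Rightarrow> int" where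
  "lower h e K k = (if k \<in> K then min (h k) (h k + e k) else h k)"

definition upper :: "(nat \<Rightarrow> int) \<Rightarrow> (nat \<Rightarrow> int) \<Rightarrow> nat set \<Rightarrow> nat \<Rightarrow> int" where
  "upper h e K k = (if k \<in> K then max (h k) (h k + e k) else h k)"

lemma toggle_empty [simp]: "toggle h e {} = h"
  by (simp add: toggle_def fun_eq_iff)

lemma toggle_toggle: "K \<inter> K' = {} \<Longrightarrow> toggle (toggle h e K) e K' = toggle h e (K' \<union> K)"
  by (auto simp: toggle_def fun_eq_iff)

section \<open>Charts of the cubes by heights\<close>

context fixes n :: nat begin

interpretation L: cubed_lattice "heights n" "{1..n}"
  by (rule cubed_lattice_heights)

text \<open>Moves do not commute in general, so order independence is read off
  \<open>fold_graph\<close>: any enumeration of \<open>T\<close> passes through toggled states, and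
  the last of them depends on the set \<open>T\<close> alone.\<close>

lemma fold_perform:
  assumes h: "h \<in> heights n" and N: "\<And>m. m \<in> N \<Longrightarrow> valid n m"
    and tog: "\<And>T. T \<subseteq> N \<Longrightarrow> toggle h e (pos n ` T) \<in> heights n" and e: "\<And>k. \<bar>e k\<bar> = 1"
    and T: "T \<subseteq> N"
  shows "Finite_Set.fold (perform n) (state n h) T = state n (toggle h e (pos n ` T))"
proof -
  have graph: "y = state n (toggle h e (pos n ` T))"
    if "fold_graph (perform n) (state n h) T y" "T \<subseteq> N" for T y
    using that
  proof (induction rule: fold_graph.induct)
    case (insertI m T y)
    let ?g = "toggle h e (pos n ` T)"
    have m: "valid n m" "pos n m \<notin> pos n ` T" using insertI N pos_inj by blast+
    have upd: "toggle h e (pos n ` insert m T) = ?g(pos n m := ?g (pos n m) + e (pos n m))"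
      using m(2) by (auto simp: toggle_def fun_eq_iff)
    have "e (pos n m) \<noteq> 0" using e[of "pos n m"] by auto
    then have "perform n m (state n ?g) = state n (toggle h e (pos n ` insert m T))"
      unfolding upd using tog[of T] tog[of "insert m T"] insertI.prems upd
      by (intro perform_state(1) m(1)) auto
    then show ?case using insertI by simp
  qed simp
  have "finite N" using N finite_valid by (metis finite_subset mem_Collect_eq subsetI)
  then have "finite T" using T finite_subset by blast
  then obtain y where "fold_graph (perform n) (state n h) T y"
    using finite_imp_fold_graph[of T "perform n" "state n h"] by blast
  then have "fold_graph (perform n) (state n h) T (state n (toggle h e (pos n ` T)))"
    using graph[OF _ T] by simp
  then have "(THE y. fold_graph (perform n) (state n h) T y) = state n (toggle h e (pos n ` T))"
    using graph[OF _ T] by (rule the_equality)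
  then show ?thesis using \<open>finite T\<close> by (simp add: Finite_Set.fold_def)
qed

text \<open>By \<open>heights_update\<close>, an entry in {1..n} cannot be both raised and lowered;
  where neither is possible, -1 is a dummy.\<close>

definition sign :: "(nat \<Rightarrow> int) \<Rightarrow> nat \<Rightarrow> int" where
  "sign h k = (if h(k := h k + 1) \<in> heights n then 1 else - 1)"

lemma charted_state_cube:
  assumes u: "u \<in> positions n" and app: "\<And>m. m \<in> N \<Longrightarrow> applicable n m u"
    and comm: "pairwise (commuting n) N"
  shows "charted n (Cube N (Finite_Set.fold (perform n) u)) (height u) (sign (height u))"
proof -
  define h where "h = height u"
  have h: "h \<in> heights n" "u = state n h" using height_position[OF u] by (simp_all add: h_def)
  have valid: "valid n m" if "m \<in> N" for m
    using applicable_update(1)[OF h(1)] app[OF that] h(2) by simp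
  have step: "h(k := h k + sign h k) \<in> heights n" if k: "k \<in> pos n ` N" for k
  proof -
    obtain m where m: "m \<in> N" "k = pos n m" using k by blast
    obtain c where c: "c \<noteq> h k" "h(k := c) \<in> heights n"
      using applicable_update(2)[OF h(1)] app[OF m(1)] h(2) m(2) by auto
    have "{h k, c} = {h (k - 1), h (k - 1) + 1}"
      using heights_update(1)[OF h(1) c(2,1)] pos_range[OF valid[OF m(1)]] m(2) by simp
    then have "c = h k + 1 \<or> c = h k - 1" by (auto simp: doubleton_eq_iff)
    then show ?thesis using c(2) by (auto simp: sign_def)
  qed
  have apart: "j + 3 \<le> k" if jk: "j \<in> pos n ` N" "k \<in> pos n ` N" "j < k" for j k
  proof -
    obtain m m' where m: "m \<in> N" "j = pos n m" "m' \<in> N" "k = pos n m'" using jk by blast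
    then have "commuting n m m'" using comm jk(3) by (auto simp: pairwise_def)
    then show ?thesis using commuting_iff[of n m m'] valid m jk(3) by auto
  qed
  have tog: "toggle h (sign h) (pos n ` T) \<in> heights n" if "T \<subseteq> N" for T
  proof (rule toggle_heights[OF h(1)])
    show "h(k := h k + sign h k) \<in> heights n" if "k \<in> pos n ` T" for k
      using step \<open>T \<subseteq> N\<close> that by blast
    show "j + 3 \<le> k" if "j \<in> pos n ` T" "k \<in> pos n ` T" "j < k" for j k
      using apart[of j k] \<open>T \<subseteq> N\<close> that by blast
  qed
  have sgn: "\<bar>sign h k\<bar> = 1" for k by (simp add: sign_def)
  show ?thesis
    unfolding charted_def h_def[symmetric]
    using valid tog sgn fold_perform[OF h(1) valid tog sgn] h(2) by simp
qed

lemma charted_state_complex: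
  assumes "c \<in> state_complex n"
  obtains h e where "charted n c h e"
  using assms charted_state_cube unfolding state_complex_def by blast

lemma chartedD:
  assumes "charted n c h e"
  shows "\<And>m. m \<in> dirs c \<Longrightarrow> valid n m" "\<And>k. e k = 1 \<or> e k = - 1" "finite (dirs c)"
    "\<And>T. T \<subseteq> dirs c \<Longrightarrow> toggle h e (pos n ` T) \<in> heights n"
    "\<And>T. T \<subseteq> dirs c \<Longrightarrow> corner c T = state n (toggle h e (pos n ` T))"
    "h \<in> heights n" "pos n ` dirs c \<subseteq> {1..n}" "inj_on (pos n) (dirs c)"
proof -
  show valid: "\<And>m. m \<in> dirs c \<Longrightarrow> valid n m" and "\<And>T. T \<subseteq> dirs c \<Longrightarrow> toggle h e (pos n ` T) \<in> heights n"
    "\<And>T. T \<subseteq> dirs c \<Longrightarrow> corner c T = state n (toggle h e (pos n ` T))"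
    using assms unfolding charted_def by blast+
  from this(2)[of "{}"] show "h \<in> heights n" by simp
  have "\<bar>e k\<bar> = 1" for k using assms unfolding charted_def by blast
  then show "e k = 1 \<or> e k = - 1" for k by (metis abs_eq_iff abs_1)
  show "finite (dirs c)" using valid finite_valid by (metis finite_subset mem_Collect_eq subsetI)
  show "pos n ` dirs c \<subseteq> {1..n}" using valid pos_range by blast
  show "inj_on (pos n) (dirs c)" unfolding inj_on_def using valid pos_inj by blast
qed

lemma toggle_diff_iff:
  assumes "charted n c h e" "T \<subseteq> dirs c" "m \<in> dirs c"
  shows "toggle h e (pos n ` T) (pos n m) = h (pos n m) + (if m \<in> T then e (pos n m) else 0)"
    and "toggle h e (pos n ` T) (pos n m) \<noteq> h (pos n m) \<longleftrightarrow> m \<in> T"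
proof -
  have "pos n m \<in> pos n ` T \<longleftrightarrow> m \<in> T"
    using chartedD(8)[OF assms(1)] assms(2,3) by (meson inj_on_image_mem_iff)
  then show "toggle h e (pos n ` T) (pos n m) = h (pos n m) + (if m \<in> T then e (pos n m) else 0)"
    by (simp add: toggle_def)
  then show "toggle h e (pos n ` T) (pos n m) \<noteq> h (pos n m) \<longleftrightarrow> m \<in> T"
    using chartedD(2)[OF assms(1), of "pos n m"] by auto
qed

lemma height_corner:
  assumes "charted n c h e" "T \<subseteq> dirs c"
  shows "height (corner c T) = toggle h e (pos n ` T)" "corner c T \<in> positions n"
  using chartedD(4,5)[OF assms] height_state state_position by simp_all

lemma corner_inj:
  assumes "charted n c h e"
  shows "inj_on (corner c) (Pow (dirs c))"
proof (rule inj_onI)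
  fix S T assume ST: "S \<in> Pow (dirs c)" "T \<in> Pow (dirs c)" "corner c S = corner c T"
  then have "toggle h e (pos n ` S) = toggle h e (pos n ` T)"
    using height_corner(1)[OF assms] by (metis PowD)
  then have "m \<in> S \<longleftrightarrow> m \<in> T" if "m \<in> dirs c" for m
    using toggle_diff_iff(2)[OF assms _ that] ST by (metis PowD)
  then show "S = T" using ST by blast
qed

lemma between_lower_upper:
  assumes c: "charted n c h e"
    and v: "\<And>k. lower h e (pos n ` dirs c) k \<le> v k" "\<And>k. v k \<le> upper h e (pos n ` dirs c) k"
  obtains T where "T \<subseteq> dirs c" "v = toggle h e (pos n ` T)"
proof
  let ?T = "{m \<in> dirs c. v (pos n m) \<noteq> h (pos n m)}"
  show "?T \<subseteq> dirs c" by blast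
  show "v = toggle h e (pos n ` ?T)"
  proof
    fix k
    show "v k = toggle h e (pos n ` ?T) k"
    proof (cases "k \<in> pos n ` dirs c")
      case True
      then obtain m where m: "m \<in> dirs c" "k = pos n m" by blast
      have "v k = h k \<or> v k = h k + e k"
        using v[of k] True chartedD(2)[OF c, of k] by (auto simp: lower_def upper_def)
      then show ?thesis
        using toggle_diff_iff(1)[OF c _ m(1), of ?T] m chartedD(2)[OF c, of k] by auto
    next
      case False
      then show ?thesis using v[of k] by (auto simp: lower_def upper_def toggle_def)
    qed
  qed
qed

lemma is_cube_chart:
  assumes c: "charted n c h e"
  shows "L.is_cube (lower h e (pos n ` dirs c)) (upper h e (pos n ` dirs c))"
  unfolding L.is_cube_def
proof (intro conjI allI subsetI)
  show "lower h e (pos n ` dirs c) \<le> upper h e (pos n ` dirs c)"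
    by (auto simp: lower_def upper_def le_fun_def)
  show "upper h e (pos n ` dirs c) k \<le> lower h e (pos n ` dirs c) k + 1" for k
    using chartedD(2)[OF c, of k] by (auto simp: lower_def upper_def)
  fix v assume "v \<in> {lower h e (pos n ` dirs c)..upper h e (pos n ` dirs c)}"
  then obtain T where "T \<subseteq> dirs c" "v = toggle h e (pos n ` T)"
    using between_lower_upper[OF c, of v] by (auto simp: le_fun_def)
  then show "v \<in> heights n" using chartedD(4)[OF c] by blast
qed

lemma box_chart:
  assumes c: "charted n c h e"
  shows "x \<in> L.box (lower h e (pos n ` dirs c)) (upper h e (pos n ` dirs c)) \<longleftrightarrow>
    (\<forall>m\<in>dirs c. e (pos n m) * (x (pos n m) - h (pos n m)) \<in> {0..1}) \<and> (\<forall>k. k \<notin> pos n ` dirs c \<longrightarrow> x k = h k)"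
proof -
  have "(real_of_int (lower h e (pos n ` dirs c) k) \<le> x k \<and> x k \<le> upper h e (pos n ` dirs c) k) \<longleftrightarrow>
     (if k \<in> pos n ` dirs c then e k * (x k - h k) \<in> {0..1} else x k = h k)" for k
    using chartedD(2)[OF c, of k] by (auto simp: lower_def upper_def)
  then show ?thesis unfolding L.box_def by auto
qed

lemma cube_point_corner:
  assumes c: "charted n c h e" and T: "T \<subseteq> dirs c"
  shows "cube_point c t (corner c T) = (\<Prod>m\<in>T. t m) * (\<Prod>m\<in>dirs c - T. 1 - t m)"
proof -
  have "{S. S \<subseteq> dirs c \<and> corner c S = corner c T} = {T}"
    using corner_inj[OF c] T by (auto simp: inj_on_def)
  then show ?thesis by (simp add: cube_point_def)
qed

lemma cube_point_embed:
  assumes c: "charted n c h e"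
    and x: "x \<in> L.box (lower h e (pos n ` dirs c)) (upper h e (pos n ` dirs c))"
    and t: "\<And>m. m \<in> dirs c \<Longrightarrow> t m = e (pos n m) * (x (pos n m) - h (pos n m))"
  shows "cube_point c t = embed n x"
proof
  fix v
  note C = chartedD[OF c]
  have x1: "t m \<in> {0..1}" if "m \<in> dirs c" for m using x t[OF that] that unfolding box_chart[OF c] by simp
  have x2: "x k = h k" if "k \<notin> pos n ` dirs c" for k using x that unfolding box_chart[OF c] by blast
  have x3: "x (pos n m) = h (pos n m) + e (pos n m) * t m" if "m \<in> dirs c" for m
    using t[OF that] C(2)[of "pos n m"] by auto
  show "cube_point c t v = embed n x v"
  proof (cases "\<exists>T\<subseteq>dirs c. v = corner c T")
    case True
    then obtain T where T: "T \<subseteq> dirs c" "v = corner c T" by blast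
    have tent: "tent (x (pos n m) - height v (pos n m)) = (if m \<in> T then t m else 1 - t m)" if m: "m \<in> dirs c" for m
      unfolding T(2) height_corner(1)[OF c T(1)] toggle_diff_iff(1)[OF c T(1) m] x3[OF m]
      using x1[OF m] C(2)[of "pos n m"] by (auto simp: tent_def)
    have "embed n x v = (\<Prod>k=1..n. tent (x k - height v k))"
      using height_corner(2)[OF c T(1)] T(2) by (simp add: embed_def)
    also have "\<dots> = (\<Prod>k\<in>pos n ` dirs c. tent (x k - height v k))"
    proof (rule prod.mono_neutral_right)
      show "\<forall>k\<in>{1..n} - pos n ` dirs c. tent (x k - height v k) = 1"
      proof
        fix k assume k: "k \<in> {1..n} - pos n ` dirs c"
        then have "height v k = h k"
          unfolding T(2) height_corner(1)[OF c T(1)] using T(1) by (auto simp: toggle_def)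
        then show "tent (x k - height v k) = 1" using x2 k by (simp add: tent_def)
      qed
    qed (use C(7) in auto)
    also have "\<dots> = (\<Prod>m\<in>dirs c. if m \<in> T then t m else 1 - t m)"
      using tent by (simp add: prod.reindex[OF C(8)])
    also have "\<dots> = (\<Prod>m\<in>dirs c - T. if m \<in> T then t m else 1 - t m) * (\<Prod>m\<in>T. if m \<in> T then t m else 1 - t m)"
      using prod.subset_diff[OF T(1) C(3)] .
    also have "\<dots> = (\<Prod>m\<in>T. t m) * (\<Prod>m\<in>dirs c - T. 1 - t m)" by simp
    finally show ?thesis using cube_point_corner[OF c T(1)] T(2) by simp
  next
    case False
    then have "{T. T \<subseteq> dirs c \<and> corner c T = v} = {}" by blast
    then have "cube_point c t v = 0" unfolding cube_point_def by (simp only: sum.empty)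
    moreover have "embed n x v = 0"
    proof (rule ccontr)
      assume ne: "embed n x v \<noteq> 0"
      then have v: "v \<in> positions n" unfolding embed_def by presburger
      then have "(\<Prod>k=1..n. tent (x k - height v k)) \<noteq> 0" using ne by (simp add: embed_def)
      then have "tent (x k - height v k) \<noteq> 0" if "k \<in> {1..n}" for k
        using that by (simp add: prod_zero_iff)
      \<comment> \<open>All factors are nonzero, so the heights of \<open>v\<close> are integers at
        distance less than 1 from \<open>x\<close>. This places them between the lowest and the
        highest corner.\<close>
      then have near: "\<bar>x k - height v k\<bar> < 1" if "k \<in> {1..n}" for k
        using that by (force simp: tent_def)
      have "lower h e (pos n ` dirs c) k \<le> height v k \<and> height v k \<le> upper h e (pos n ` dirs c) k" for k
      proof (cases "k \<in> pos n ` dirs c")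
        case True
        then obtain m where m: "m \<in> dirs c" "k = pos n m" by blast
        have "\<bar>h k + e k * t m - height v k\<bar> < 1" using near[of k] True C(7) x3[OF m(1)] m(2) by auto
        then show ?thesis using x1[OF m(1)] C(2)[of k] True by (auto simp: lower_def upper_def)
      next
        case False
        have "height v k = h k"
        proof (cases "k \<in> {1..n}")
          case True
          then show ?thesis using near[OF True] x2[OF False] by auto
        next
          case outside: False
          then show ?thesis using L.off[OF C(6)] L.off[OF height_position(1)[OF v]] by simp
        qed
        then show ?thesis using False by (simp add: lower_def upper_def)
      qed
      then obtain T where "T \<subseteq> dirs c" "height v = toggle h e (pos n ` T)"
        using between_lower_upper[OF c, of "height v"] by blast
      then have "v = corner c T" using C(5) height_position(2)[OF v] by metis
      then show False using False \<open>T \<subseteq> dirs c\<close> by blast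
    qed
    ultimately show ?thesis by simp
  qed
qed

lemma cell_chart:
  assumes c: "charted n c h e"
  shows "cell c = embed n ` L.box (lower h e (pos n ` dirs c)) (upper h e (pos n ` dirs c))" (is "_ = _ ` ?B")
proof
  note C = chartedD[OF c]
  show "embed n ` ?B \<subseteq> cell c"
  proof (rule image_subsetI)
    fix x assume x: "x \<in> ?B"
    define t where "t = (\<lambda>m. e (pos n m) * (x (pos n m) - h (pos n m)))"
    have "t \<in> dirs c \<rightarrow> {0..1}" using x unfolding box_chart[OF c] by (auto simp: t_def)
    moreover have "embed n x = cube_point c t"
      using cube_point_embed[OF c x, of t] by (simp add: t_def)
    ultimately show "embed n x \<in> cell c" unfolding cell_def by blast
  qed
  show "cell c \<subseteq> embed n ` ?B"
  proof
    fix p assume "p \<in> cell c"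
    then obtain t where t: "t \<in> dirs c \<rightarrow> {0..1}" "p = cube_point c t" by (auto simp: cell_def)
    define x where "x = (\<lambda>k. if k \<in> pos n ` dirs c then h k + e k * t (inv_into (dirs c) (pos n) k) else real_of_int (h k))"
    have x: "e (pos n m) * (x (pos n m) - h (pos n m)) = t m" if "m \<in> dirs c" for m
      using that C(2)[of "pos n m"] by (auto simp: x_def inv_into_f_f[OF C(8)])
    have "x \<in> ?B" unfolding box_chart[OF c]
    proof (intro conjI ballI allI impI)
      show "e (pos n m) * (x (pos n m) - h (pos n m)) \<in> {0..1}" if "m \<in> dirs c" for m
        unfolding x[OF that] using t(1) that by blast
    qed (simp add: x_def)
    moreover have "p = embed n x" using cube_point_embed[OF c \<open>x \<in> ?B\<close>, of t] x t(2) by simp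
    ultimately show "p \<in> embed n ` ?B" by blast
  qed
qed

lemma coord_embed:
  assumes c: "charted n c h e"
    and x: "x \<in> L.box (lower h e (pos n ` dirs c)) (upper h e (pos n ` dirs c))" and m: "m \<in> dirs c"
  shows "coord c (embed n x) m = e (pos n m) * (x (pos n m) - h (pos n m))"
proof -
  define t where "t = (\<lambda>m. e (pos n m) * (x (pos n m) - h (pos n m)))"
  have "embed n x = cube_point c t" using cube_point_embed[OF c x, of t] by (simp add: t_def)
  then show ?thesis
    using coord_cube_point[OF chartedD(3)[OF c] corner_inj[OF c] m, of t] by (simp add: t_def)
qed

lemma cube_dist_embed:
  assumes c: "charted n c h e"
    and x: "x \<in> L.box (lower h e (pos n ` dirs c)) (upper h e (pos n ` dirs c))"
    and y: "y \<in> L.box (lower h e (pos n ` dirs c)) (upper h e (pos n ` dirs c))"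
  shows "cube_dist c (embed n x) (embed n y) = L.edist x y"
proof -
  note C = chartedD[OF c]
  have "(\<Sum>m\<in>dirs c. (coord c (embed n x) m - coord c (embed n y) m)\<^sup>2)
      = (\<Sum>m\<in>dirs c. (x (pos n m) - y (pos n m))\<^sup>2)"
  proof (rule sum.cong)
    fix m assume m: "m \<in> dirs c"
    show "(coord c (embed n x) m - coord c (embed n y) m)\<^sup>2 = (x (pos n m) - y (pos n m))\<^sup>2"
      unfolding coord_embed[OF c x m] coord_embed[OF c y m]
      using C(2)[of "pos n m"] by (auto simp: power2_commute)
  qed simp
  also have "\<dots> = (\<Sum>k\<in>pos n ` dirs c. (x k - y k)\<^sup>2)"
    by (simp add: sum.reindex[OF C(8)])
  also have "\<dots> = (\<Sum>k=1..n. (x k - y k)\<^sup>2)"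
  proof (rule sum.mono_neutral_left)
    show "\<forall>k\<in>{1..n} - pos n ` dirs c. (x k - y k)\<^sup>2 = 0"
      using x y unfolding box_chart[OF c] by simp
  qed (use C(7) in auto)
  finally show ?thesis unfolding cube_dist_def L.edist_def L2_set_def by (simp only:)
qed

text \<open>In the expectation of a height the total weight 1 contributes the base height, and the
  probability that direction \<open>m\<close> is traversed is the coordinate
  \<open>coord c p m\<close>.\<close>

lemma unembed_embed:
  assumes c: "charted n c h e"
    and x: "x \<in> L.box (lower h e (pos n ` dirs c)) (upper h e (pos n ` dirs c))"
  shows "unembed n (embed n x) = x"
proof
  fix k
  note C = chartedD[OF c]
  define t where "t = (\<lambda>m. e (pos n m) * (x (pos n m) - h (pos n m)))"
  define p where "p = embed n x"
  have p: "p = cube_point c t" using cube_point_embed[OF c x, of t] by (simp add: t_def p_def)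
  have "unembed n p k = (\<Sum>v\<in>corner c ` Pow (dirs c). p v * height v k)"
    unfolding unembed_def
  proof (rule sum.mono_neutral_right)
    show "\<forall>v\<in>positions n - corner c ` Pow (dirs c). p v * height v k = 0"
    proof
      fix v assume "v \<in> positions n - corner c ` Pow (dirs c)"
      then have "{T. T \<subseteq> dirs c \<and> corner c T = v} = {}" by blast
      then have "p v = 0" unfolding p cube_point_def by (simp only: sum.empty)
      then show "p v * height v k = 0" by simp
    qed
    show "corner c ` Pow (dirs c) \<subseteq> positions n" using height_corner(2)[OF c] by blast
  qed (rule finite_positions)
  also have "\<dots> = (\<Sum>T\<in>Pow (dirs c). p (corner c T) * height (corner c T) k)"
    by (simp add: sum.reindex[OF corner_inj[OF c]])
  also have "\<dots> = (\<Sum>T\<in>Pow (dirs c). p (corner c T) * h k + (if k \<in> pos n ` T then p (corner c T) * e k else 0))"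
    by (intro sum.cong) (auto simp: height_corner(1)[OF c] toggle_def algebra_simps)
  also have "\<dots> = (\<Sum>T\<in>Pow (dirs c). p (corner c T)) * h k + (\<Sum>T\<in>Pow (dirs c). if k \<in> pos n ` T then p (corner c T) * e k else 0)"
    by (simp add: sum.distrib sum_distrib_right)
  also have "(\<Sum>T\<in>Pow (dirs c). p (corner c T)) = (\<Prod>m\<in>dirs c. t m + (1 - t m))"
    unfolding prod_add[OF C(3)] by (intro sum.cong) (auto simp: p cube_point_corner[OF c])
  also have "\<dots> = 1" by simp
  also have "(\<Sum>T\<in>Pow (dirs c). if k \<in> pos n ` T then p (corner c T) * e k else 0) = x k - h k"
  proof (cases "k \<in> pos n ` dirs c")
    case True
    then obtain m where m: "m \<in> dirs c" "k = pos n m" by blast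
    have "k \<in> pos n ` T \<longleftrightarrow> m \<in> T" if "T \<in> Pow (dirs c)" for T
      using C(8) that m by (metis PowD inj_on_image_mem_iff)
    then have "(\<Sum>T\<in>Pow (dirs c). if k \<in> pos n ` T then p (corner c T) * e k else 0)
        = (\<Sum>T\<in>Pow (dirs c). if m \<in> T then p (corner c T) * e k else 0)"
      by (intro sum.cong) auto
    also have "\<dots> = (\<Sum>T | T \<subseteq> dirs c \<and> m \<in> T. p (corner c T) * e k)"
      using C(3) by (subst sum.inter_filter[symmetric]) (auto intro!: sum.cong)
    also have "\<dots> = coord c p m * e k" by (simp add: coord_def sum_distrib_right)
    also have "\<dots> = x k - h k"
      unfolding p_def coord_embed[OF c x m(1)] using m(2) C(2)[of k] by auto
    finally show ?thesis .
  next
    case False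
    then have "(\<Sum>T\<in>Pow (dirs c). if k \<in> pos n ` T then p (corner c T) * e k else 0) = 0"
      by (intro sum.neutral) auto
    then show ?thesis using x False unfolding box_chart[OF c] by simp
  qed
  finally show "unembed n (embed n x) k = x k" by (simp add: p_def)
qed

text \<open>The converse of \<open>is_cube_chart\<close>: based at its lowest corner, an integer
  cube is spanned by the moves at the entries where \<open>l\<close> and \<open>u\<close>
  differ.\<close>

lemma cube_of_box:
  assumes lu: "L.is_cube l u"
  obtains c e where "c \<in> state_complex n" "charted n c l e"
    "lower l e (pos n ` dirs c) = l" "upper l e (pos n ` dirs c) = u"
proof -
  note q = L.is_cubeD[OF lu]
  define N where "N = {m. valid n m \<and> l (pos n m) < u (pos n m)}"
  define c where "c = Cube N (Finite_Set.fold (perform n) (state n l))"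
  have le: "l k \<le> u k" for k using q(3) by (simp add: le_fun_def)
  have up: "l(k := l k + 1) \<in> heights n" if "l k < u k" for k
    using that le by (intro q(5)) (auto simp: le_fun_def)
  have app: "applicable n m (state n l)" if "m \<in> N" for m
    using that up[of "pos n m"] by (intro perform_state(2)[of l n m "l (pos n m) + 1"] q(1)) (auto simp: N_def)
  \<comment> \<open>For closer entries, raising \<open>j\<close> alone forces a later entry above
    \<open>l j\<close>, and then raising \<open>k\<close> alone breaks the bound by entry
    \<open>j\<close>.\<close>
  have apart: "j + 3 \<le> k" if jk: "l j < u j" "l k < u k" "j < k" "k \<le> n" for j k
  proof (rule ccontr)
    assume "\<not> j + 3 \<le> k"
    then consider "k = Suc j" | "k = Suc (Suc j)" using jk(3) by linarith
    then show False
    proof cases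
      case 1
      then have "l j + 1 \<le> l (Suc j)" "l (Suc j) + 1 \<le> l j + 1"
        using heightsD(2)[OF up[OF jk(1)], of j] heightsD(3)[OF up[OF jk(2)], of j] jk(4) by auto
      then show False by simp
    next
      case 2
      then have "l j + 1 \<le> l (Suc j)" "l (Suc (Suc j)) + 1 \<le> l j + 1" "l (Suc j) \<le> l (Suc (Suc j))"
        using heightsD(2)[OF up[OF jk(1)], of j] heightsD(4)[OF up[OF jk(2)], of j]
          heightsD(2)[OF q(1), of "Suc j"] jk(4) by auto
      then show False by simp
    qed
  qed
  have comm: "pairwise (commuting n) N"
    unfolding pairwise_def
  proof (intro ballI impI)
    fix m m' assume m: "m \<in> N" "m' \<in> N" "m \<noteq> m'"
    then have v: "valid n m" "valid n m'" by (auto simp: N_def)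
    then have ne: "pos n m \<noteq> pos n m'" using pos_inj m(3) by blast
    have le: "pos n m \<le> n" "pos n m' \<le> n" using pos_range[OF v(1)] pos_range[OF v(2)] by auto
    have lt: "l (pos n m) < u (pos n m)" "l (pos n m') < u (pos n m')" using m by (auto simp: N_def)
    show "commuting n m m'"
      unfolding commuting_iff[OF v]
      using apart[OF lt _ le(2)] apart[OF lt(2,1) _ le(1)] ne by (meson linorder_neqE_nat)
  qed
  have "c \<in> state_complex n"
    using state_position[OF q(1)] app comm by (auto simp: state_complex_def c_def)
  moreover have ch: "charted n c l (sign l)"
    using charted_state_cube[OF state_position[OF q(1)] app comm] height_state[OF q(1)] by (simp add: c_def)
  moreover have N: "k \<in> pos n ` dirs c \<longleftrightarrow> l k < u k" for k
  proof
    assume "l k < u k"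
    then have "k \<in> {1..n}" using L.off[OF q(1), of k] L.off[OF q(2), of k] by fastforce
    then obtain m where "valid n m" "pos n m = k" using pos_surj by blast
    then show "k \<in> pos n ` dirs c" using \<open>l k < u k\<close> by (force simp: c_def N_def)
  qed (auto simp: c_def N_def)
  have "sign l k = 1" if "l k < u k" for k using up[OF that] by (simp add: sign_def)
  then have "lower l (sign l) (pos n ` dirs c) k = l k \<and> upper l (sign l) (pos n ` dirs c) k = u k" for k
    using N[of k] le[of k] q(4)[of k] by (auto simp: lower_def upper_def)
  then have "lower l (sign l) (pos n ` dirs c) = l" "upper l (sign l) (pos n ` dirs c) = u" by auto
  ultimately show ?thesis using that by blast
qed

text \<open>The left inverse \<open>unembed\<close> does not refer to a cube, so it also separates
  points of different cubes.\<close>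

lemma embed_inj: "inj_on (embed n) L.points"
proof (rule inj_on_inverseI)
  fix x assume "x \<in> L.points"
  then obtain l u where lu: "L.is_cube l u" "x \<in> L.box l u" by (rule L.pointsE)
  obtain c e where "charted n c l e"
    "lower l e (pos n ` dirs c) = l" "upper l e (pos n ` dirs c) = u"
    by (rule cube_of_box[OF lu(1)])
  then show "unembed n (embed n x) = x" using unembed_embed lu(2) by metis
qed

lemma charted_face:
  assumes c: "charted n c h e" and J: "J \<subseteq> dirs c" "K \<subseteq> dirs c - J"
  shows "charted n (Cube J (\<lambda>T. corner c (T \<union> K))) (toggle h e (pos n ` K)) e"
  unfolding charted_def
proof (intro conjI allI ballI impI)
  note C = chartedD[OF c]
  show "valid n m" if "m \<in> dirs (Cube J (\<lambda>T. corner c (T \<union> K)))" for m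
    using that J C(1) by auto
  show "\<bar>e k\<bar> = 1" for k using C(2)[of k] by auto
  fix T assume "T \<subseteq> dirs (Cube J (\<lambda>T. corner c (T \<union> K)))"
  then have T: "T \<subseteq> J" by simp
  then have "pos n ` K \<inter> pos n ` T = {}"
    using inj_on_image_Int[OF C(8), of K T] J by blast
  then have "toggle (toggle h e (pos n ` K)) e (pos n ` T) = toggle h e (pos n ` (T \<union> K))"
    by (simp add: toggle_toggle image_Un)
  moreover have "T \<union> K \<subseteq> dirs c" using T J by blast
  ultimately show "toggle (toggle h e (pos n ` K)) e (pos n ` T) \<in> heights n"
    "corner (Cube J (\<lambda>T. corner c (T \<union> K))) T = state n (toggle (toggle h e (pos n ` K)) e (pos n ` T))"
    using C(4,5)[of "T \<union> K"] by simp_all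
qed

lemma sub_box_face:
  assumes c: "charted n c h e"
    and lu: "\<And>k. lower h e (pos n ` dirs c) k \<le> l k" "\<And>k. l k \<le> u k" "\<And>k. u k \<le> upper h e (pos n ` dirs c) k"
  shows "embed n ` L.box l u \<in> faces c"
proof -
  note C = chartedD[OF c]
  define J where "J = {m \<in> dirs c. l (pos n m) < u (pos n m)}"
  \<comment> \<open>The directions in which the sub-box is flat and sits at the end opposite to the
    base vertex.\<close>
  define K where "K = {m \<in> dirs c - J. l (pos n m) \<noteq> h (pos n m)}"
  have JK: "J \<subseteq> dirs c" "K \<subseteq> dirs c - J" by (auto simp: J_def K_def)
  define f where "f = Cube J (\<lambda>T. corner c (T \<union> K))"
  define g where "g = toggle h e (pos n ` K)"
  have f: "charted n f g e" unfolding f_def g_def by (rule charted_face[OF c JK])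
  have "lower g e (pos n ` dirs f) k = l k \<and> upper g e (pos n ` dirs f) k = u k" for k
  proof (cases "k \<in> pos n ` dirs c")
    case True
    then obtain m where m: "m \<in> dirs c" "k = pos n m" by blast
    have J: "k \<in> pos n ` J \<longleftrightarrow> m \<in> J" and K: "k \<in> pos n ` K \<longleftrightarrow> m \<in> K"
      using C(8) m JK by (meson Diff_subset inj_on_image_mem_iff subset_trans)+
    have "k \<in> pos n ` J \<longleftrightarrow> l k < u k" "k \<in> pos n ` K \<longleftrightarrow> l k = u k \<and> l k \<noteq> h k"
      unfolding J K using m lu(2)[of k] by (auto simp: J_def K_def)
    then show ?thesis
      using lu[of k] True C(2)[of k] by (auto simp: f_def g_def toggle_def lower_def upper_def)
  next
    case False
    then have "k \<notin> pos n ` J" "k \<notin> pos n ` K" using JK by auto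
    then show ?thesis using lu[of k] False by (simp add: f_def g_def toggle_def lower_def upper_def)
  qed
  then have "lower g e (pos n ` dirs f) = l" "upper g e (pos n ` dirs f) = u" by auto
  then have "embed n ` L.box l u = cell f" using cell_chart[OF f] by simp
  then show ?thesis unfolding faces_def f_def using JK by blast
qed

lemma cubical_state_complex: "cubical_complex (state_complex n)"
  unfolding cubical_complex_def
proof (intro conjI ballI impI)
  fix c assume "c \<in> state_complex n"
  then obtain h e where c: "charted n c h e" by (rule charted_state_complex)
  show "finite (dirs c)" "inj_on (corner c) (Pow (dirs c))"
    using chartedD(3)[OF c] corner_inj[OF c] .
  show "faces c \<subseteq> cell ` state_complex n"
  proof
    fix F assume "F \<in> faces c"
    then obtain J K where F: "F = cell (Cube J (\<lambda>T. corner c (T \<union> K)))" and JK: "J \<subseteq> dirs c" "K \<subseteq> dirs c - J"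
      unfolding faces_def by blast
    define f where "f = Cube J (\<lambda>T. corner c (T \<union> K))"
    define g where "g = toggle h e (pos n ` K)"
    have f: "charted n f g e" unfolding f_def g_def by (rule charted_face[OF c JK])
    \<comment> \<open>Only the cell has to occur in the complex: the cube found is based at the
      lowest corner of the face, whatever the base of the face was.\<close>
    obtain c' e' where c': "c' \<in> state_complex n" "charted n c' (lower g e (pos n ` dirs f)) e'"
      "lower (lower g e (pos n ` dirs f)) e' (pos n ` dirs c') = lower g e (pos n ` dirs f)"
      "upper (lower g e (pos n ` dirs f)) e' (pos n ` dirs c') = upper g e (pos n ` dirs f)"
      by (rule cube_of_box[OF is_cube_chart[OF f]])
    then have "cell c' = cell f" using cell_chart[OF c'(2)] cell_chart[OF f] by simp
    then show "F \<in> cell ` state_complex n" using F c'(1) by (auto simp: f_def)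
  qed
next
  fix c c' assume "c \<in> state_complex n" "c' \<in> state_complex n"
  then obtain h e h' e' where c: "charted n c h e" and c': "charted n c' h' e'"
    by (meson charted_state_complex)
  define l u l' u' where "l = lower h e (pos n ` dirs c)" "u = upper h e (pos n ` dirs c)"
    "l' = lower h' e' (pos n ` dirs c')" "u' = upper h' e' (pos n ` dirs c')"
  note lu = this
  note cell = cell_chart[OF c, folded lu(1,2)] cell_chart[OF c', folded lu(3,4)]
  note cube = is_cube_chart[OF c, folded lu(1,2)] is_cube_chart[OF c', folded lu(3,4)]
  have Int: "cell c \<inter> cell c' = embed n ` L.box (sup l l') (inf u u')"
    unfolding cell L.box_Int[symmetric]
    using inj_on_image_Int[OF embed_inj L.box_points[OF cube(1)] L.box_points[OF cube(2)]] by simp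
  show "cell c \<inter> cell c' \<in> faces c \<inter> faces c'" if "cell c \<inter> cell c' \<noteq> {}"
  proof -
    have "L.box l u \<inter> L.box l' u' \<noteq> {}" using that unfolding Int L.box_Int by blast
    then have le: "sup l l' k \<le> inf u u' k" for k
      using L.is_cubeD(3)[OF L.is_cube_Int[OF cube]] unfolding le_fun_def by blast
    show ?thesis
      unfolding Int using le
      by (intro IntI sub_box_face[OF c] sub_box_face[OF c']) (simp_all flip: lu)
  qed
  fix p q assume "p \<in> cell c \<inter> cell c'" "q \<in> cell c \<inter> cell c'"
  then obtain x y where xy: "p = embed n x" "q = embed n y"
    "x \<in> L.box l u" "x \<in> L.box l' u'" "y \<in> L.box l u" "y \<in> L.box l' u'"
    unfolding Int L.box_Int[symmetric] by blast
  then show "cube_dist c p q = cube_dist c' p q"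
    using cube_dist_embed[OF c, folded lu(1,2)] cube_dist_embed[OF c', folded lu(3,4)] by simp
qed

lemma realization_state_complex: "realization (state_complex n) = embed n ` L.points"
proof
  show "realization (state_complex n) \<subseteq> embed n ` L.points"
  proof
    fix p assume "p \<in> realization (state_complex n)"
    then obtain c where "c \<in> state_complex n" "p \<in> cell c" by (auto simp: realization_def)
    moreover from this(1) obtain h e where c: "charted n c h e" by (rule charted_state_complex)
    ultimately show "p \<in> embed n ` L.points"
      using cell_chart[OF c] L.box_points[OF is_cube_chart[OF c]] by blast
  qed
  show "embed n ` L.points \<subseteq> realization (state_complex n)"
  proof (rule image_subsetI)
    fix x assume "x \<in> L.points"
    then obtain l u where lu: "L.is_cube l u" "x \<in> L.box l u" by (rule L.pointsE)
    obtain c e where c: "c \<in> state_complex n" "charted n c l e"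
      "lower l e (pos n ` dirs c) = l" "upper l e (pos n ` dirs c) = u"
      by (rule cube_of_box[OF lu(1)])
    then have "embed n x \<in> cell c" using cell_chart[OF c(2)] lu(2) by simp
    then show "embed n x \<in> realization (state_complex n)" using c(1) by (auto simp: realization_def)
  qed
qed

section \<open>Transfer of paths, distances and the CAT(0) property\<close>

lemma path_imp_pl_path:
  "L.path x y k \<Longrightarrow> pl_path (state_complex n) (embed n x) (embed n y) k"
proof (induction rule: L.path.induct)
  case (path_refl p)
  then show ?case using realization_state_complex by (intro pl_path_refl) blast
next
  case (path_step l u p q r k)
  obtain c e where c: "c \<in> state_complex n" "charted n c l e"
    "lower l e (pos n ` dirs c) = l" "upper l e (pos n ` dirs c) = u"
    by (rule cube_of_box[OF path_step.hyps(1)])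
  have "embed n p \<in> cell c" "embed n q \<in> cell c"
    using cell_chart[OF c(2)] c(3,4) path_step.hyps by auto
  then have "pl_path (state_complex n) (embed n p) (embed n r) (cube_dist c (embed n p) (embed n q) + k)"
    using c(1) path_step.IH by (intro pl_path_step)
  moreover have "cube_dist c (embed n p) (embed n q) = L.edist p q"
    using cube_dist_embed[OF c(2)] c(3,4) path_step.hyps by simp
  ultimately show ?case by simp
qed

lemma pl_path_imp_path:
  "pl_path (state_complex n) p q k \<Longrightarrow>
    \<exists>x\<in>L.points. \<exists>y\<in>L.points. p = embed n x \<and> q = embed n y \<and> L.path x y k"
proof (induction rule: pl_path.induct)
  case (pl_path_refl p)
  then obtain x where "x \<in> L.points" "p = embed n x"
    unfolding realization_state_complex by blast
  then show ?case using L.path_refl[of x] by auto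
next
  case (pl_path_step c p q r k)
  then obtain y z where yz: "y \<in> L.points" "z \<in> L.points" "q = embed n y" "r = embed n z" "L.path y z k"
    by blast
  obtain h e where c: "charted n c h e" using pl_path_step.hyps(1) by (rule charted_state_complex)
  define l u where "l = lower h e (pos n ` dirs c)" "u = upper h e (pos n ` dirs c)"
  note lu = this
  note cube = is_cube_chart[OF c, folded lu]
  obtain x y' where x: "x \<in> L.box l u" "p = embed n x" and y': "y' \<in> L.box l u" "q = embed n y'"
    using pl_path_step.hyps cell_chart[OF c, folded lu] by auto
  \<comment> \<open>Consecutive segments come with charts of different cubes; injectivity identifies
    the coordinates of their common breakpoint.\<close>
  have "y' = y" using embed_inj y' yz L.box_points[OF cube] by (meson inj_onD subsetD)
  then have "L.path x z (L.edist x y + k)" using x y' yz(5) cube by (intro L.path_step) auto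
  moreover have "cube_dist c p q = L.edist x y"
    using cube_dist_embed[OF c, folded lu] x y' \<open>y' = y\<close> by simp
  ultimately show ?case using x yz L.box_points[OF cube] by (metis subsetD)
qed

lemma pl_dist_embed:
  assumes "x \<in> L.points" "y \<in> L.points"
  shows "pl_dist (state_complex n) (embed n x) (embed n y) = L.cdist x y"
proof -
  have "pl_path (state_complex n) (embed n x) (embed n y) k \<longleftrightarrow> L.path x y k" for k
  proof
    assume "pl_path (state_complex n) (embed n x) (embed n y) k"
    then obtain x' y' where xy: "x' \<in> L.points" "y' \<in> L.points" "embed n x = embed n x'"
      "embed n y = embed n y'" "L.path x' y' k" using pl_path_imp_path by blast
    then have "x = x'" "y = y'" using inj_onD[OF embed_inj] assms by auto
    then show "L.path x y k" using xy(5) by simp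
  qed (rule path_imp_pl_path)
  then have "pl_path (state_complex n) (embed n x) (embed n y) = L.path x y" by (rule ext)
  then show ?thesis unfolding pl_dist_def L.cdist_def by (simp only:)
qed

text \<open>\<open>Metric_space\<close> asks for nonnegativity and symmetry also outside the
  carrier, where the dummy value 0 applies.\<close>

lemma pl_dist_outside:
  assumes "p \<notin> embed n ` L.points \<or> q \<notin> embed n ` L.points"
  shows "pl_dist (state_complex n) p q = 0"
proof -
  have "\<not> pl_path (state_complex n) p q k" for k using assms pl_path_imp_path by blast
  then show ?thesis by (simp add: pl_dist_def)
qed

lemma CAT0_state_complex:
  "CAT0_space (realization (state_complex n)) (pl_dist (state_complex n))"
proof -
  let ?M = "embed n ` L.points" and ?d = "pl_dist (state_complex n)"
  interpret M: Metric_space ?M ?d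
  proof
    fix p q
    have "0 \<le> ?d p q \<and> ?d p q = ?d q p"
    proof (cases "p \<in> ?M \<and> q \<in> ?M")
      case True
      then obtain x y where xy: "x \<in> L.points" "y \<in> L.points" "p = embed n x" "q = embed n y" by blast
      show ?thesis
        unfolding xy(3,4) pl_dist_embed[OF xy(1,2)] pl_dist_embed[OF xy(2,1)]
        using L.P.nonneg L.P.commute by blast
    next
      case False
      then show ?thesis using pl_dist_outside[of p q] pl_dist_outside[of q p] by auto
    qed
    then show "0 \<le> ?d p q" "?d p q = ?d q p" by blast+
  next
    fix p q assume "p \<in> ?M" "q \<in> ?M"
    then obtain x y where xy: "x \<in> L.points" "y \<in> L.points" "p = embed n x" "q = embed n y" by blast
    show "?d p q = 0 \<longleftrightarrow> p = q"
      unfolding xy(3,4) pl_dist_embed[OF xy(1,2)] inj_on_eq_iff[OF embed_inj xy(1,2)]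
      using xy(1,2) by (rule L.P.zero)
  next
    fix p q r assume "p \<in> ?M" "q \<in> ?M" "r \<in> ?M"
    then obtain x y z where xyz: "x \<in> L.points" "y \<in> L.points" "z \<in> L.points"
      "p = embed n x" "q = embed n y" "r = embed n z" by blast
    show "?d p r \<le> ?d p q + ?d q r"
      unfolding xyz(4-6) pl_dist_embed[OF xyz(1,2)] pl_dist_embed[OF xyz(2,3)] pl_dist_embed[OF xyz(1,3)]
      by (rule L.P.triangle[OF xyz(1-3)])
  qed
  have "M.CN ?M"
    unfolding M.CN_def
  proof (intro ballI)
    fix p q and t :: real assume pq: "p \<in> ?M" "q \<in> ?M" and t: "t \<in> {0..1}"
    then obtain y z where yz: "y \<in> L.points" "z \<in> L.points" "p = embed n y" "q = embed n z" by blast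
    obtain m where m: "m \<in> L.points" "\<And>x. x \<in> L.points \<Longrightarrow> L.P.cn x y z t m"
      using L.P.CN_point[OF L.CN_points yz(1,2) t] by blast
    have "M.cn (embed n x) p q t (embed n m)" if "x \<in> L.points" for x
      using m(2)[OF that] unfolding M.cn_def L.P.cn_def yz(3,4) by (simp add: pl_dist_embed that yz m)
    then show "\<exists>m\<in>?M. \<forall>x\<in>?M. M.cn x p q t m" using m(1) by blast
  qed
  then show ?thesis unfolding realization_state_complex by (rule M.CN_imp_CAT0)
qed

end

theorem theorem5p9:
  fixes n :: nat
  assumes "n \<ge> 1"
  shows "CAT0_cubical_complex (state_complex n)"
  unfolding CAT0_cubical_complex_def using cubical_state_complex CAT0_state_complex ..

end
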